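(* Let $(\nu_n)_{n\ge1}$ be a sequence of probability measures on $\mathbb{Z}$ and let $a>0$, $0\le\rho<1$ be constants such that for all $n$: (1) $E(\nu_n)=\sum_k k\,\nu_n(k)=0$; (2) $m_1(\nu_n)=\sum_k|k|\nu_n(k)\le a$; (3) $\nu_n(\beta\mathbb{Z}+r)\le\rho$ for all integers $\beta\notin\{1,-1\}$ and all $r\in\mathbb{Z}$ (with $0\cdot\mathbb{Z}+r=\{r\}$); (4) $\phi(n)=\sum_{i=1}^n m_2(\nu_i)=O(n)$, where $m_2(\nu)=\sum_k k^2\nu(k)$. Let $\mu_n=\nu_1*\cdots*\nu_n$. Then for every $f\in L^1(X)$, $\mu_nf(x)=\sum_{k\in\mathbb{Z}}\mu_n(k)f(\tau^kx)$ converges for $m$-almost every $x\in X$.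
   Context: $(X,\mathcal{B},m)$ is a non-atomic separable probability space and $\tau:X\to X$ is an invertible measure-preserving transformation. Convolution: $(\mu*\nu)(k)=\sum_{j}\mu(k-j)\nu(j)$. *)

theory Defs
  imports "HOL-Probability.Probability"
begin

definition is_prob_int :: "(int \<Rightarrow> real) \<Rightarrow> bool" where
  "is_prob_int \<nu> \<longleftrightarrow> (\<forall>k. 0 \<le> \<nu> k) \<and> (\<nu> has_sum 1) UNIV"

definition conv_int :: "(int \<Rightarrow> real) \<Rightarrow> (int \<Rightarrow> real) \<Rightarrow> int \<Rightarrow> real" where
  "conv_int \<mu> \<nu> k = (\<Sum>\<^sub>\<infinity>j\<in>UNIV. \<mu> (k - j) * \<nu> j)"

fun conv_prod :: "(nat \<Rightarrow> int \<Rightarrow> real) \<Rightarrow> nat \<Rightarrow> int \<Rightarrow> real" where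
  "conv_prod \<nu> 0 = (\<lambda>k. if k = 0 then 1 else 0)"
| "conv_prod \<nu> (Suc 0) = \<nu> 1"
| "conv_prod \<nu> (Suc (Suc n)) = conv_int (conv_prod \<nu> (Suc n)) (\<nu> (Suc (Suc n)))"

definition mean_int :: "(int \<Rightarrow> real) \<Rightarrow> real" where
  "mean_int \<nu> = (\<Sum>\<^sub>\<infinity>k\<in>UNIV. real_of_int k * \<nu> k)"

definition m1_int :: "(int \<Rightarrow> real) \<Rightarrow> real" where
  "m1_int \<nu> = (\<Sum>\<^sub>\<infinity>k\<in>UNIV. \<bar>real_of_int k\<bar> * \<nu> k)"

definition m2_int :: "(int \<Rightarrow> real) \<Rightarrow> real" where
  "m2_int \<nu> = (\<Sum>\<^sub>\<infinity>k\<in>UNIV. (real_of_int k)\<^sup>2 * \<nu> k)"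

definition coset_mass :: "(int \<Rightarrow> real) \<Rightarrow> int \<Rightarrow> int \<Rightarrow> real" where
  "coset_mass \<nu> \<beta> r = (\<Sum>\<^sub>\<infinity>k\<in>{k. \<exists>j. k = \<beta> * j + r}. \<nu> k)"

definition non_atomic :: "'a measure \<Rightarrow> bool" where
  "non_atomic M \<longleftrightarrow> (\<forall>A\<in>sets M. 0 < emeasure M A \<longrightarrow>
      (\<exists>B\<in>sets M. B \<subseteq> A \<and> 0 < emeasure M B \<and> emeasure M B < emeasure M A))"

definition separable_measure :: "'a measure \<Rightarrow> bool" where
  "separable_measure M \<longleftrightarrow> (\<exists>\<E>. countable \<E> \<and> \<E> \<subseteq> sets M \<and>
      (\<forall>A\<in>sets M. \<forall>e>0. \<exists>E\<in>\<E>. measure M ((A - E) \<union> (E - A)) < e))"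

definition int_iter :: "('a \<Rightarrow> 'a) \<Rightarrow> 'a set \<Rightarrow> int \<Rightarrow> 'a \<Rightarrow> 'a" where
  "int_iter \<tau> S k = (if 0 \<le> k then \<tau> ^^ nat k else the_inv_into S \<tau> ^^ nat (- k))"

end

theory Submission
  imports Defs
begin

text \<open>
  Write \<open>\<mu>\<^sub>n\<close> for the convolution product. The coset condition gives a uniform Gaussian bound
  \<open>exp (- c t\<^sup>2)\<close> for the Fourier transforms of the \<open>\<nu>\<^sub>i\<close> on \<open>[- \<pi>, \<pi>]\<close>; together with the zero means and
  \<open>\<phi>(n) = O(n)\<close> it controls the transform of \<open>\<mu>\<^sub>n\<close> and its second derivative, and Fourier inversion yields
  \<open>\<bar>\<mu>\<^sub>n(k) - \<mu>\<^sub>n(k + 1)\<bar> \<le> C / n\<close> and \<open>k\<^sup>2 \<mu>\<^sub>n(k) \<le> C \<surd>n\<close>. By summation by parts for \<open>\<bar>k\<bar> \<le> A \<surd>n\<close> and the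
  second bound for the tail, the weighted averages converge at every point where the forward and backward Birkhoff
  averages of \<open>f\<close> have a common limit and those of \<open>\<bar>f\<bar>\<close> stay bounded. The two-sided Birkhoff theorem
  shows that this is almost every point.
\<close>

section \<open>The two-sided pointwise ergodic theorem\<close>

text \<open>The argument is pointwise: once the Birkhoff averages are controlled at a point,
  convergence there is a deterministic statement about the kernels. The scales are critical:
  differences of size C / n against partial sums of size \<epsilon> k, over A sqrt n indices, cost
  A^2 \<epsilon>, while the tail costs 1 / A independently of n; so A is fixed first and \<epsilon>
  afterwards. Mean zero gives the second derivative its size: the first derivative of each transform
  vanishes at 0, so the square of the accumulated second moment appears only with a factor t^2, and
  for t of order 1 / sqrt n both terms have order n. The two directions must share one limit because
  nothing controls how the mass of a kernel divides between positive and negative k; with a common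
  limit only the total mass 1 matters. The obstacle to uniform constants is that the measures vary
  with n. The first moment bound confines enough mass to a fixed interval, which has only finitely
  many subsets, and this turns the arithmetic coset condition into one constant c.\<close>

fun maxsum :: "('a \<Rightarrow> 'a) \<Rightarrow> ('a \<Rightarrow> real) \<Rightarrow> nat \<Rightarrow> 'a \<Rightarrow> real" where
  "maxsum T g 0 x = 0"
| "maxsum T g (Suc n) x = max 0 (g x + maxsum T g n (T x))"

text \<open>With \<open>g = f - \<beta>\<close> this set contains every point at which the upper limit of the Birkhoff
  averages of \<open>f\<close> exceeds \<open>\<beta>\<close>; unlike the set defined by that upper limit, it is invariant for
  trivial reasons.\<close>
definition unbdd :: "'a measure \<Rightarrow> ('a \<Rightarrow> 'a) \<Rightarrow> ('a \<Rightarrow> real) \<Rightarrow> 'a set" where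
  "unbdd M T g = {x \<in> space M. \<forall>K::nat. \<exists>n. real K < maxsum T g n x}"

lemma maxsum_nonneg: "0 \<le> maxsum T g n x"
  by (cases n) auto

lemma maxsum_Suc_ge: "maxsum T g n x \<le> maxsum T g (Suc n) x"
proof (induction n arbitrary: x)
  case (Suc n)
  show ?case using Suc[of "T x"] by (simp add: max_def)
qed simp

lemma maxsum_mono: "m \<le> n \<Longrightarrow> maxsum T g m x \<le> maxsum T g n x"
  by (rule lift_Suc_mono_le[of "\<lambda>n. maxsum T g n x"]) (rule maxsum_Suc_ge)

text \<open>\<open>maxsum T g n x\<close> is the maximum of the orbit sums of length at most
  \<open>n\<close>, the empty sum included. The recursive form is the identity on which Garsia's
  proof of the maximal ergodic theorem rests.\<close>

lemma orbit_sum_le_maxsum: "(\<Sum>k<n. g ((T ^^ k) x)) \<le> maxsum T g n x"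
proof (induction n arbitrary: x)
  case (Suc n)
  have "(\<Sum>k<Suc n. g ((T ^^ k) x)) = g x + (\<Sum>k<n. g ((T ^^ k) (T x)))"
    by (subst sum.lessThan_Suc_shift) (simp add: funpow_swap1)
  thus ?case using Suc[of "T x"] by simp
qed simp

lemma maxsum_borel_measurable:
  assumes [measurable]: "T \<in> measurable M M" "g \<in> borel_measurable M"
  shows "maxsum T g n \<in> borel_measurable M"
proof (induction n)
  case 0
  have "maxsum T g 0 = (\<lambda>_. 0)" by auto
  thus ?case by simp
next
  case (Suc n)
  note Suc[measurable]
  have "maxsum T g (Suc n) = (\<lambda>x. max 0 (g x + maxsum T g n (T x)))" by auto
  thus ?case by simp
qed

lemma unbdd_sets:
  assumes [measurable]: "T \<in> measurable M M" "g \<in> borel_measurable M"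
  shows "unbdd M T g \<in> sets M"
proof -
  note maxsum_borel_measurable[OF assms, measurable]
  show ?thesis unfolding unbdd_def by measurable
qed

text \<open>Up to truncation at 0 and an index shift, one step of \<open>T\<close> changes
  \<open>maxsum\<close> by the fixed finite amount \<open>g x\<close>, which cannot affect
  boundedness in \<open>n\<close>.\<close>

lemma unbdd_invariant:
  assumes "T \<in> measurable M M" "x \<in> space M"
  shows "T x \<in> unbdd M T g \<longleftrightarrow> x \<in> unbdd M T g"
proof -
  have Tx: "T x \<in> space M" using assms by (auto dest: measurable_space)
  have "(\<forall>K::nat. \<exists>n. real K < maxsum T g n (T x)) \<longleftrightarrow> (\<forall>K::nat. \<exists>n. real K < maxsum T g n x)"
  proof (intro iffI allI)
    fix K :: nat assume h: "\<forall>K::nat. \<exists>n. real K < maxsum T g n (T x)"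
    obtain L :: nat where L: "\<bar>g x\<bar> \<le> real L" using real_arch_simple by blast
    obtain n where "real (K + L) < maxsum T g n (T x)" using h by blast
    hence "real K < maxsum T g (Suc n) x" using L unfolding maxsum.simps of_nat_add by linarith
    thus "\<exists>n. real K < maxsum T g n x" by blast
  next
    fix K :: nat assume h: "\<forall>K::nat. \<exists>n. real K < maxsum T g n x"
    obtain L :: nat where L: "\<bar>g x\<bar> \<le> real L" using real_arch_simple by blast
    obtain n where n: "real (K + L) < maxsum T g n x" using h by blast
    then obtain m where "n = Suc m" by (cases n) auto
    with n L have "real K < maxsum T g m (T x)" unfolding maxsum.simps of_nat_add by simp
    thus "\<exists>n. real K < maxsum T g n (T x)" by blast
  qed
  thus ?thesis using assms Tx by (simp add: unbdd_def)
qed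

lemma integrable_comp_mpt:
  fixes g :: "'a \<Rightarrow> real"
  assumes T: "T \<in> measurable M M" "distr M M T = M" and g: "integrable M g"
  shows "integrable M (\<lambda>x. g (T x))" "(\<integral>x. g (T x) \<partial>M) = (\<integral>x. g x \<partial>M)"
proof -
  have gm: "g \<in> borel_measurable M" using g by simp
  show "integrable M (\<lambda>x. g (T x))"
    using integrable_distr_eq[OF T(1) gm] T g by simp
  show "(\<integral>x. g (T x) \<partial>M) = (\<integral>x. g x \<partial>M)"
    using integral_distr[OF T(1) gm] T by simp
qed

lemma integrable_maxsum:
  assumes T: "T \<in> measurable M M" "distr M M T = M" and g: "integrable M g"
  shows "integrable M (maxsum T g n)"
proof (induction n)
  case 0
  have "maxsum T g 0 = (\<lambda>_. 0)" by auto
  thus ?case by simp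
next
  case (Suc n)
  have "integrable M (\<lambda>x. max 0 (g x + maxsum T g n (T x)))"
    by (intro integrable_max integrable_zero Bochner_Integration.integrable_add g integrable_comp_mpt[OF T Suc])
  moreover have "maxsum T g (Suc n) = (\<lambda>x. max 0 (g x + maxsum T g n (T x)))" by auto
  ultimately show ?case by simp
qed

text \<open>Since \<open>maxsum T g (Suc n) - maxsum T g n \<circ> T = max g (- maxsum T g n \<circ> T)\<close> and \<open>maxsum\<close> increases
  with \<open>n\<close>, the integral of the right-hand side over \<open>A\<close> is nonnegative, and on \<open>A\<close> it is eventually \<open>g\<close>.\<close>
lemma maximal_ergodic:
  assumes T: "T \<in> measurable M M" "distr M M T = M" and g: "integrable M g"
    and A: "A \<in> sets M" "A \<subseteq> unbdd M T g" and inv: "\<And>x. x \<in> space M \<Longrightarrow> T x \<in> A \<longleftrightarrow> x \<in> A"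
  shows "0 \<le> (\<integral>x. indicator A x * g x \<partial>M)"
proof -
  have int_ind: "integrable M (\<lambda>x. indicator A x * h x)" if "integrable M h" for h :: "'a \<Rightarrow> real"
    using integrable_mult_indicator[OF A(1) that] by simp
  note im = integrable_maxsum[OF T g]
  note imT = integrable_comp_mpt[OF T im]
  have gm[measurable]: "g \<in> borel_measurable M" using g by simp
  note maxsum_borel_measurable[OF T(1) gm, measurable]
  note T(1)[measurable] A(1)[measurable]
  have pos: "0 \<le> (\<integral>x. indicator A x * max (g x) (- maxsum T g n (T x)) \<partial>M)" for n
  proof -
    \<comment> \<open>Invariance turns \<open>indicator A x\<close> into
      \<open>indicator A (T x)\<close>, so that measure preservation applies to the whole
      product.\<close>
    have "(\<integral>x. indicator A x * maxsum T g n (T x) \<partial>M)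
        = (\<integral>x. indicator A (T x) * maxsum T g n (T x) \<partial>M)"
      by (rule Bochner_Integration.integral_cong) (auto simp: indicator_def inv)
    also have "\<dots> = (\<integral>x. indicator A x * maxsum T g n x \<partial>M)"
      by (rule integrable_comp_mpt(2)[OF T int_ind[OF im]])
    also have "\<dots> \<le> (\<integral>x. indicator A x * maxsum T g (Suc n) x \<partial>M)"
      by (intro integral_mono int_ind im mult_left_mono maxsum_Suc_ge) auto
    finally have "0 \<le> (\<integral>x. indicator A x * maxsum T g (Suc n) x \<partial>M)
         - (\<integral>x. indicator A x * maxsum T g n (T x) \<partial>M)" by simp
    also have "\<dots> = (\<integral>x. indicator A x * maxsum T g (Suc n) x - indicator A x * maxsum T g n (T x) \<partial>M)"
      by (intro Bochner_Integration.integral_diff[symmetric] int_ind im imT)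
    also have "\<dots> = (\<integral>x. indicator A x * max (g x) (- maxsum T g n (T x)) \<partial>M)"
      by (rule Bochner_Integration.integral_cong) (auto simp: indicator_def)
    finally show ?thesis .
  qed
  have "(\<lambda>n. \<integral>x. indicator A x * max (g x) (- maxsum T g n (T x)) \<partial>M)
      \<longlonglongrightarrow> (\<integral>x. indicator A x * g x \<partial>M)"
  proof (rule integral_dominated_convergence[where w="\<lambda>x. \<bar>g x\<bar>"])
    show "integrable M (\<lambda>x. \<bar>g x\<bar>)" using g by simp
    show "AE x in M. (\<lambda>n. indicator A x * max (g x) (- maxsum T g n (T x)))
        \<longlonglongrightarrow> indicator A x * g x"
    proof (rule AE_I2)
      fix x assume x: "x \<in> space M"
      show "(\<lambda>n. indicator A x * max (g x) (- maxsum T g n (T x))) \<longlonglongrightarrow> indicator A x * g x"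
      proof (cases "x \<in> A")
        case True
        hence "T x \<in> unbdd M T g" using A inv x by auto
        moreover obtain L :: nat where L: "\<bar>g x\<bar> \<le> real L" using real_arch_simple by blast
        ultimately obtain N where N: "real L < maxsum T g N (T x)" by (auto simp: unbdd_def)
        have "\<forall>\<^sub>F n in sequentially. indicator A x * g x = indicator A x * max (g x) (- maxsum T g n (T x))"
          using eventually_ge_at_top[of N]
        proof eventually_elim
          case (elim n)
          have "- maxsum T g n (T x) \<le> g x" using N L maxsum_mono[OF elim, of T g "T x"] by linarith
          thus ?case by simp
        qed
        thus ?thesis by (rule Lim_transform_eventually[OF tendsto_const])
      qed simp
    qed
    \<comment> \<open>Since \<open>- maxsum\<close> is at most 0, the maximum lies between
      \<open>g x\<close> and \<open>max (g x) 0\<close>.\<close>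
    show "AE x in M. norm (indicator A x * max (g x) (- maxsum T g n (T x))) \<le> \<bar>g x\<bar>" for n
    proof (rule AE_I2)
      fix x
      show "norm (indicator A x * max (g x) (- maxsum T g n (T x))) \<le> \<bar>g x\<bar>"
        using maxsum_nonneg[of T g n "T x"] by (auto simp: indicator_def max_def)
    qed
  qed auto
  thus ?thesis by (rule LIMSEQ_le_const) (use pos in auto)
qed

section \<open>Birkhoff's theorem for an invertible map and its inverse\<close>

locale inv_mpt = prob_space M for M :: "'a measure" +
  fixes \<tau> \<sigma> :: "'a \<Rightarrow> 'a"
  assumes mpt: "\<tau> \<in> measurable M M" "distr M M \<tau> = M" "\<sigma> \<in> measurable M M" "distr M M \<sigma> = M"
    and inverse: "\<And>x. x \<in> space M \<Longrightarrow> \<tau> (\<sigma> x) = x" "\<And>x. x \<in> space M \<Longrightarrow> \<sigma> (\<tau> x) = x"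
begin

lemma mpt_dir:
  assumes "s \<in> {\<tau>, \<sigma>}" shows "s \<in> measurable M M" "distr M M s = M"
  using assms mpt by auto

text \<open>If \<open>s\<close> and \<open>t\<close> differ they undo each other, so invariance
  under \<open>t\<close> is applied at the point \<open>s x\<close>. This permits intersecting sets
  that belong to opposite directions.\<close>

lemma unbdd_invariant2:
  assumes "s \<in> {\<tau>, \<sigma>}" "t \<in> {\<tau>, \<sigma>}" "x \<in> space M"
  shows "s x \<in> unbdd M t g \<longleftrightarrow> x \<in> unbdd M t g"
proof -
  have sx: "s x \<in> space M" using mpt_dir[OF assms(1)] assms(3) by (auto dest: measurable_space)
  have "s = t \<or> t (s x) = x" using assms inverse by auto
  thus ?thesis
    using unbdd_invariant[OF mpt_dir(1)[OF assms(2)] assms(3), of g]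
          unbdd_invariant[OF mpt_dir(1)[OF assms(2)] sx, of g] by auto
qed

lemma set_integral_shift:
  fixes f :: "'a \<Rightarrow> real"
  assumes "integrable M f" "A \<in> sets M"
  shows "(\<integral>x. indicator A x * (f x - c) \<partial>M) = (\<integral>x. indicator A x * f x \<partial>M) - c * prob A"
proof -
  have "(\<integral>x. indicator A x * (f x - c) \<partial>M) = (\<integral>x. indicator A x * f x - c * indicator A x \<partial>M)"
    by (rule Bochner_Integration.integral_cong) (auto simp: algebra_simps)
  also have "\<dots> = (\<integral>x. indicator A x * f x \<partial>M) - (\<integral>x. c * indicator A x \<partial>M)"
    using integrable_mult_indicator[OF assms(2,1)] assms(2)
    by (intro Bochner_Integration.integral_diff) (auto simp: emeasure_eq_measure)
  also have "(\<integral>x. c * indicator A x \<partial>M) = c * prob A" using assms(2) by simp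
  finally show ?thesis .
qed

text \<open>On the invariant set where both fail, the maximal inequality for direction
  \<open>s\<close> makes the integral of \<open>f\<close> at least \<open>\<beta>\<close> times the
  measure, and for \<open>- f\<close> in direction \<open>t\<close> at most \<open>\<alpha>\<close>
  times the measure. Allowing \<open>s \<noteq> t\<close> is what later identifies the forward and
  backward limits.\<close>

lemma AE_not_unbdd_both:
  assumes f: "integrable M f" and s: "s \<in> {\<tau>, \<sigma>}" "t \<in> {\<tau>, \<sigma>}" and "\<alpha> < \<beta>"
  shows "AE x in M. x \<notin> unbdd M s (\<lambda>x. f x - \<beta>) \<or> x \<notin> unbdd M t (\<lambda>x. - f x - (- \<alpha>))"
proof -
  let ?A = "unbdd M s (\<lambda>x. f x - \<beta>) \<inter> unbdd M t (\<lambda>x. - f x - (- \<alpha>))"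
  note u = unbdd_sets[OF mpt_dir(1)[OF s(1)]] unbdd_sets[OF mpt_dir(1)[OF s(2)]]
  have fm: "f \<in> borel_measurable M" using f by simp
  have A: "?A \<in> sets M" using fm by (intro sets.Int u) auto
  have inv: "r x \<in> ?A \<longleftrightarrow> x \<in> ?A" if "r \<in> {\<tau>, \<sigma>}" "x \<in> space M" for r x
    using unbdd_invariant2[OF that(1) s(1) that(2)] unbdd_invariant2[OF that(1) s(2) that(2)] by auto
  have "0 \<le> (\<integral>x. indicator ?A x * (f x - \<beta>) \<partial>M)"
    by (rule maximal_ergodic[OF mpt_dir[OF s(1)] _ A _ inv[OF s(1)]]) (use f in auto)
  moreover have "0 \<le> (\<integral>x. indicator ?A x * (- f x - (- \<alpha>)) \<partial>M)"
    by (rule maximal_ergodic[OF mpt_dir[OF s(2)] _ A _ inv[OF s(2)]]) (use f in auto)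
  moreover have "(\<integral>x. indicator ?A x * (- f x - (- \<alpha>)) \<partial>M)
      = (\<integral>x. indicator ?A x * (- f x) \<partial>M) - (- \<alpha>) * prob ?A"
    by (rule set_integral_shift[OF _ A]) (use f in simp)
  ultimately have "0 \<le> (\<alpha> - \<beta>) * prob ?A"
    using set_integral_shift[OF f A, of \<beta>] by (simp add: algebra_simps)
  hence "prob ?A \<le> 0" using \<open>\<alpha> < \<beta>\<close> by (simp add: zero_le_mult_iff)
  hence "prob ?A = 0" using measure_nonneg[of M ?A] by (rule antisym)
  hence "AE x in M. x \<notin> ?A" using A by (simp add: prob_eq_0)
  thus ?thesis by eventually_elim auto
qed

text \<open>On the intersection over all \<open>n\<close> the maximal inequality bounds
  \<open>n\<close> times its measure by one fixed integral. This excludes infinite averages.\<close>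

lemma AE_ex_not_unbdd:
  assumes f: "integrable M f" and s: "s \<in> {\<tau>, \<sigma>}"
  shows "AE x in M. \<exists>n::nat. x \<notin> unbdd M s (\<lambda>x. f x - real n)"
proof -
  let ?A = "\<Inter>n::nat. unbdd M s (\<lambda>x. f x - real n)"
  have fm: "f \<in> borel_measurable M" using f by simp
  have A: "?A \<in> sets M" using fm by (intro sets.countable_INT' unbdd_sets mpt_dir[OF s]) (auto intro!: unbdd_sets mpt_dir[OF s])
  have "real n * prob ?A \<le> (\<integral>x. indicator ?A x * f x \<partial>M)" for n :: nat
  proof -
    have "0 \<le> (\<integral>x. indicator ?A x * (f x - real n) \<partial>M)"
    proof (rule maximal_ergodic[OF mpt_dir[OF s] _ A])
      show "s x \<in> ?A \<longleftrightarrow> x \<in> ?A" if "x \<in> space M" for x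
        using unbdd_invariant2[OF s s that] by auto
    qed (use f in auto)
    thus ?thesis using set_integral_shift[OF f A, of "real n"] by simp
  qed
  hence "\<not> 0 < prob ?A" using ex_less_of_nat_mult[of "prob ?A"] not_less by blast
  hence "prob ?A = 0" using measure_nonneg[of M ?A] by linarith
  hence "AE x in M. x \<notin> ?A" using A by (simp add: prob_eq_0)
  thus ?thesis by eventually_elim auto
qed

text \<open>Affine bounds \<open>\<beta> * real N + K\<close> take the place of upper limits: they
  come directly from boundedness of \<open>maxsum\<close>, and summation by parts uses them in this
  form.\<close>

lemma orbit_sum_le:
  assumes "x \<in> space M" "x \<notin> unbdd M s (\<lambda>x. f x - \<beta>)"
  shows "\<exists>K. \<forall>N. (\<Sum>k<N. f ((s ^^ k) x)) \<le> \<beta> * real N + K"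
proof -
  obtain K :: nat where K: "\<And>n. maxsum s (\<lambda>x. f x - \<beta>) n x \<le> real K"
    using assms by (auto simp: unbdd_def not_less)
  have "(\<Sum>k<N. f ((s ^^ k) x)) \<le> \<beta> * real N + real K" for N
    using orbit_sum_le_maxsum[where g="\<lambda>x. f x - \<beta>" and T=s and n=N and x=x] K[of N] by (simp add: sum_subtractf algebra_simps)
  thus ?thesis by blast
qed

lemma AE_orbit_sum_linear_bound:
  assumes f: "integrable M f" and s: "s \<in> {\<tau>, \<sigma>}"
  shows "AE x in M. \<exists>\<beta> K. \<forall>N. (\<Sum>k<N. f ((s ^^ k) x)) \<le> \<beta> * real N + K"
  using AE_ex_not_unbdd[OF f s] AE_space
proof eventually_elim
  case (elim x)
  then obtain n where "x \<notin> unbdd M s (\<lambda>x. f x - real n)" by blast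
  from orbit_sum_le[OF elim(2) this] show ?case by blast
qed

text \<open>The limit is the infimum of the rates that bound the \<open>\<tau>\<close>-orbit sums
  from above. The dichotomy between upper and lower bounds, valid for every pair of directions,
  transfers this number to lower bounds and to \<open>\<sigma>\<close>.\<close>

lemma birkhoff_two_sided:
  assumes f: "integrable M f"
  shows "AE x in M. \<exists>F. \<forall>s\<in>{\<tau>, \<sigma>}. \<forall>\<epsilon>>0. \<exists>K. \<forall>N. \<bar>(\<Sum>k<N. f ((s ^^ k) x)) - F * real N\<bar> \<le> \<epsilon> * real N + K"
proof -
  \<comment> \<open>Rational thresholds keep the number of exceptional null sets countable.\<close>
  have 1: "AE x in M. \<forall>s\<in>{\<tau>, \<sigma>}. \<forall>t\<in>{\<tau>, \<sigma>}. \<forall>p::rat\<times>rat. fst p < snd p \<longrightarrow>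
     x \<notin> unbdd M s (\<lambda>x. f x - of_rat (snd p)) \<or> x \<notin> unbdd M t (\<lambda>x. - f x - (- of_rat (fst p)))"
    by (intro AE_finite_allI AE_all_countable[THEN iffD2] allI AE_impI AE_not_unbdd_both f) (auto simp: of_rat_less)
  have 2: "AE x in M. \<forall>s\<in>{\<tau>, \<sigma>}. \<exists>\<beta> K. \<forall>N. (\<Sum>k<N. f ((s ^^ k) x)) \<le> \<beta> * real N + K"
    by (intro AE_finite_allI AE_orbit_sum_linear_bound f) auto
  have 3: "AE x in M. \<forall>s\<in>{\<tau>, \<sigma>}. \<exists>\<beta> K. \<forall>N. (\<Sum>k<N. - f ((s ^^ k) x)) \<le> \<beta> * real N + K"
    using f by (intro AE_finite_allI AE_orbit_sum_linear_bound) auto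
  show ?thesis using 1 2 3 AE_space
  proof eventually_elim
    case (elim x)
    define S where "S s N = (\<Sum>k<N. f ((s ^^ k) x))" for s N
    define up where "up s \<beta> \<longleftrightarrow> (\<exists>K. \<forall>N. S s N \<le> \<beta> * real N + K)" for s \<beta>
    define lo where "lo s \<alpha> \<longleftrightarrow> (\<exists>K. \<forall>N. \<alpha> * real N - K \<le> S s N)" for s \<alpha>
    have dich: "up s (of_rat q) \<or> lo t (of_rat p)" if "s \<in> {\<tau>, \<sigma>}" "t \<in> {\<tau>, \<sigma>}" "p < q" for s t p q
    proof -
      have "x \<notin> unbdd M s (\<lambda>x. f x - of_rat q) \<or> x \<notin> unbdd M t (\<lambda>x. - f x - (- of_rat p))"
        using elim(1) that by fastforce
      thus ?thesis
      proof
        assume "x \<notin> unbdd M s (\<lambda>x. f x - of_rat q)"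
        thus ?thesis using orbit_sum_le[OF elim(4)] by (auto simp: up_def S_def)
      next
        assume "x \<notin> unbdd M t (\<lambda>x. - f x - (- of_rat p))"
        then obtain K where K: "\<And>N. (\<Sum>k<N. - f ((t ^^ k) x)) \<le> - of_rat p * real N + K"
          using orbit_sum_le[OF elim(4), of t "\<lambda>x. - f x"] by blast
        have "of_rat p * real N - K \<le> S t N" for N using K[of N] by (simp add: S_def sum_negf)
        hence "lo t (of_rat p)" by (auto simp: lo_def)
        thus ?thesis ..
      qed
    qed
    \<comment> \<open>A lower slope above an upper slope would be contradicted at large
      \<open>N\<close>, whatever the additive constants.\<close>
    have cmp: "\<alpha> \<le> \<beta>" if "lo s \<alpha>" "up s \<beta>" for s \<alpha> \<beta>
    proof (rule ccontr)
      assume "\<not> \<alpha> \<le> \<beta>"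
      hence d: "0 < \<alpha> - \<beta>" by simp
      from that obtain K K' where K: "\<And>N. \<alpha> * real N - K \<le> S s N" "\<And>N. S s N \<le> \<beta> * real N + K'"
        by (auto simp: lo_def up_def)
      obtain N :: nat where "K + K' < real N * (\<alpha> - \<beta>)" using ex_less_of_nat_mult[OF d] by blast
      thus False using K[of N] by (simp add: algebra_simps)
    qed
    have up_mono: "up s \<gamma>" if "up s \<beta>" "\<beta> \<le> \<gamma>" for s \<beta> \<gamma>
    proof -
      from that obtain K where K: "\<And>N. S s N \<le> \<beta> * real N + K" by (auto simp: up_def)
      have "S s N \<le> \<gamma> * real N + K" for N
        using K[of N] mult_right_mono[OF that(2), of "real N"] by simp
      thus ?thesis by (auto simp: up_def)
    qed
    have lo_mono: "lo s \<gamma>" if "lo s \<beta>" "\<gamma> \<le> \<beta>" for s \<beta> \<gamma>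
    proof -
      from that obtain K where K: "\<And>N. \<beta> * real N - K \<le> S s N" by (auto simp: lo_def)
      have "\<gamma> * real N - K \<le> S s N" for N
        using K[of N] mult_right_mono[OF that(2), of "real N"] by simp
      thus ?thesis by (auto simp: lo_def)
    qed
    obtain \<beta>0 where \<beta>0: "up \<tau> \<beta>0" using elim(2) by (auto simp: up_def S_def)
    obtain \<alpha>0 where \<alpha>0: "lo \<tau> \<alpha>0"
    proof -
      obtain \<beta> K where K: "\<And>N. (\<Sum>k<N. - f ((\<tau> ^^ k) x)) \<le> \<beta> * real N + K" using elim(3) by auto
      have "- \<beta> * real N - K \<le> S \<tau> N" for N using K[of N] by (simp add: S_def sum_negf)
      hence "lo \<tau> (- \<beta>)" by (auto simp: lo_def)
      thus ?thesis by (rule that)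
    qed
    define F where "F = Inf {\<beta>. up \<tau> \<beta>}"
    have bdd: "bdd_below {\<beta>. up \<tau> \<beta>}" using cmp[OF \<alpha>0] by (auto intro!: bdd_belowI)
    have upF: "up s (F + \<epsilon>)" if s: "s \<in> {\<tau>, \<sigma>}" and "0 < \<epsilon>" for s \<epsilon>
    proof -
      obtain \<beta> where \<beta>: "up \<tau> \<beta>" "\<beta> < F + \<epsilon>"
        using cInf_lessD[of "{\<beta>. up \<tau> \<beta>}" "F + \<epsilon>"] \<beta>0 \<open>0 < \<epsilon>\<close> by (auto simp: F_def)
      \<comment> \<open>The dichotomy needs two distinct rationals: \<open>p\<close> is too large to
        be a lower rate for \<open>\<tau>\<close>, which leaves \<open>q\<close> as an upper rate
        for \<open>s\<close>.\<close>
      obtain p where p: "\<beta> < real_of_rat p" "real_of_rat p < F + \<epsilon>" using of_rat_dense[OF \<beta>(2)] by blast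
      obtain q where q: "real_of_rat p < real_of_rat q" "real_of_rat q < F + \<epsilon>" using of_rat_dense[OF p(2)] by blast
      have "\<not> lo \<tau> (of_rat p)" using cmp[OF _ \<beta>(1)] p by fastforce
      hence "up s (of_rat q)" using dich[OF s, of \<tau> p q] q(1) by (simp add: of_rat_less)
      thus ?thesis using q(2) by (auto intro: up_mono)
    qed
    have loF: "lo s (F - \<epsilon>)" if s: "s \<in> {\<tau>, \<sigma>}" and "0 < \<epsilon>" for s \<epsilon>
    proof -
      have "F - \<epsilon> < F" using \<open>0 < \<epsilon>\<close> by simp
      then obtain p where p: "F - \<epsilon> < real_of_rat p" "real_of_rat p < F" using of_rat_dense by blast
      obtain q where q: "real_of_rat p < real_of_rat q" "real_of_rat q < F" using of_rat_dense[OF p(2)] by blast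
      have "\<not> up \<tau> (of_rat q)" using cInf_lower[OF _ bdd, of "of_rat q"] q(2) by (auto simp: F_def)
      hence "lo s (of_rat p)" using dich[OF _ s, of \<tau> p q] q(1) by (simp add: of_rat_less)
      thus ?thesis using p(1) by (auto intro: lo_mono)
    qed
    show ?case
    proof (rule exI[of _ F], intro ballI allI impI)
      fix s \<epsilon> assume s: "s \<in> {\<tau>, \<sigma>}" and \<epsilon>: "0 < (\<epsilon>::real)"
      obtain K K' where K: "\<And>N. S s N \<le> (F + \<epsilon>) * real N + K" "\<And>N. (F - \<epsilon>) * real N - K' \<le> S s N"
        using upF[OF s \<epsilon>] loF[OF s \<epsilon>] by (auto simp: up_def lo_def)
      have "\<bar>(\<Sum>k<N. f ((s ^^ k) x)) - F * real N\<bar> \<le> \<epsilon> * real N + max K K'" for N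
        using K[of N] unfolding S_def by (simp add: algebra_simps abs_le_iff max_def)
      thus "\<exists>K. \<forall>N. \<bar>(\<Sum>k<N. f ((s ^^ k) x)) - F * real N\<bar> \<le> \<epsilon> * real N + K" by blast
    qed
  qed
qed

end

section \<open>Fourier transforms of weights on the integers\<close>

no_notation Infinite_Set_Sum.abs_summable_on (infix "abs'_summable'_on" 50)

definition fourier :: "(int \<Rightarrow> real) \<Rightarrow> real \<Rightarrow> complex" where
  "fourier w t = (\<Sum>\<^sub>\<infinity>k. of_real (w k) * cis (of_int k * t))"

definition mom :: "(int \<Rightarrow> real) \<Rightarrow> int \<Rightarrow> real" where
  "mom w k = of_int k * w k"

lemma abs_summable_fourier:
  assumes "w summable_on UNIV"
  shows "(\<lambda>k. complex_of_real (w k) * cis (of_int k * t)) abs_summable_on UNIV"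
proof -
  have "(\<lambda>k. norm (complex_of_real (w k) * cis (of_int k * t))) = (\<lambda>k. norm (w k))"
    by (simp add: norm_mult)
  thus ?thesis using summable_on_iff_abs_summable_on_real assms by metis
qed

lemma fourier_has_sum:
  assumes "w summable_on UNIV"
  shows "((\<lambda>k. complex_of_real (w k) * cis (of_int k * t)) has_sum fourier w t) UNIV"
  unfolding fourier_def by (rule has_sum_infsum[OF abs_summable_summable[OF abs_summable_fourier[OF assms]]])

text \<open>Fubini for the absolutely summable product family, transported by the shear that sends
  \<open>(k, j)\<close> to \<open>(k - j, j)\<close>.\<close>

lemma convolution_has_sum:
  fixes u v :: "int \<Rightarrow> 'b :: {banach, real_normed_field}"
  assumes u: "u abs_summable_on UNIV" and v: "v abs_summable_on UNIV"
  shows "(\<lambda>j. u (k - j) * v j) abs_summable_on UNIV"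
    and "(\<lambda>k. \<Sum>\<^sub>\<infinity>j. u (k - j) * v j) abs_summable_on UNIV"
    and "((\<lambda>k. \<Sum>\<^sub>\<infinity>j. u (k - j) * v j) has_sum infsum u UNIV * infsum v UNIV) UNIV"
proof -
  define f where "f = (\<lambda>(i, j). u i * v j)"
  define g where "g = (\<lambda>(k, j). u (k - j) * v j)"
  have bij: "bij_betw (\<lambda>(k, j). (k - j, j)) UNIV (UNIV :: (int \<times> int) set)"
    by (rule bij_betwI[where g="\<lambda>(i, j). (i + j, j)"]) auto
  have gf: "g = (\<lambda>p. f (case p of (k, j) \<Rightarrow> (k - j, j)))" by (auto simp: f_def g_def)
  have f: "f abs_summable_on UNIV \<times> UNIV"
  proof (rule Infinite_Sum.abs_summable_on_Sigma_iff[THEN iffD2], intro conjI ballI)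
    show "(\<lambda>y. f (x, y)) abs_summable_on UNIV" for x
      using summable_on_cmult_right[OF v, of "norm (u x)"] by (simp add: f_def norm_mult)
    have "(\<lambda>x. \<Sum>\<^sub>\<infinity>y. norm (f (x, y))) = (\<lambda>x. norm (u x) * (\<Sum>\<^sub>\<infinity>y. norm (v y)))"
      by (simp add: f_def norm_mult infsum_cmult_right')
    thus "(\<lambda>x. \<Sum>\<^sub>\<infinity>y. norm (f (x, y))) abs_summable_on UNIV"
      using summable_on_cmult_left[OF u] by (simp add: abs_mult infsum_nonneg)
  qed
  hence "(\<lambda>p. norm (f (case p of (k, j) \<Rightarrow> (k - j, j)))) summable_on UNIV"
    using summable_on_reindex_bij_betw[OF bij, of "\<lambda>p. norm (f p)"] unfolding UNIV_Times_UNIV by blast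
  hence g: "g abs_summable_on UNIV \<times> UNIV" unfolding gf UNIV_Times_UNIV .
  note gi = g[unfolded Infinite_Sum.abs_summable_on_Sigma_iff]
  show 1: "(\<lambda>j. u (k - j) * v j) abs_summable_on UNIV" for k using gi by (auto simp: g_def)
  have fs: "(f has_sum infsum f (UNIV \<times> UNIV)) (UNIV \<times> UNIV)"
    by (rule has_sum_infsum[OF abs_summable_summable[OF f]])
  have "((\<lambda>i. u i * infsum v UNIV) has_sum infsum f (UNIV \<times> UNIV)) UNIV"
    by (rule has_sum_SigmaD[OF fs])
       (auto simp: f_def intro!: has_sum_cmult_right has_sum_infsum abs_summable_summable[OF v])
  moreover have "((\<lambda>i. u i * infsum v UNIV) has_sum infsum u UNIV * infsum v UNIV) UNIV"
    by (intro has_sum_cmult_left has_sum_infsum abs_summable_summable[OF u])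
  ultimately have F: "infsum f (UNIV \<times> UNIV) = infsum u UNIV * infsum v UNIV" by (rule has_sum_unique)
  have gs: "(g has_sum infsum f (UNIV \<times> UNIV)) (UNIV \<times> UNIV)"
    using fs has_sum_reindex_bij_betw[OF bij, of f] unfolding gf UNIV_Times_UNIV by blast
  have "((\<lambda>k. \<Sum>\<^sub>\<infinity>j. u (k - j) * v j) has_sum infsum f (UNIV \<times> UNIV)) UNIV"
    by (rule has_sum_SigmaD[OF gs]) (auto simp: g_def intro!: has_sum_infsum abs_summable_summable[OF 1])
  thus "((\<lambda>k. \<Sum>\<^sub>\<infinity>j. u (k - j) * v j) has_sum infsum u UNIV * infsum v UNIV) UNIV" unfolding F .
  show "(\<lambda>k. \<Sum>\<^sub>\<infinity>j. u (k - j) * v j) abs_summable_on UNIV"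
  proof (rule Infinite_Sum.abs_summable_on_comparison_test)
    show "(\<lambda>k. \<Sum>\<^sub>\<infinity>j. norm (g (k, j))) abs_summable_on UNIV" using gi by simp
    show "norm (\<Sum>\<^sub>\<infinity>j. u (k - j) * v j) \<le> norm (\<Sum>\<^sub>\<infinity>j. norm (g (k, j)))" for k
      using norm_infsum_bound[OF 1, of k] by (simp add: g_def)
  qed
qed

lemma
  assumes "u summable_on UNIV" "v summable_on UNIV"
  shows conv_int_inner_summable: "(\<lambda>j. u (k - j) * v j) summable_on UNIV"
    and conv_int_summable: "conv_int u v summable_on UNIV"
    and conv_int_has_sum: "(conv_int u v has_sum infsum u UNIV * infsum v UNIV) UNIV"
proof -
  have uv: "u abs_summable_on UNIV" "v abs_summable_on UNIV"
    using assms summable_on_iff_abs_summable_on_real by blast+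
  note C = convolution_has_sum[OF uv]
  show "(\<lambda>j. u (k - j) * v j) summable_on UNIV" by (rule abs_summable_summable[OF C(1)])
  show "(conv_int u v has_sum infsum u UNIV * infsum v UNIV) UNIV"
    unfolding conv_int_def by (rule C(3))
  thus "conv_int u v summable_on UNIV" by (rule has_sum_imp_summable)
qed

text \<open>The character is multiplicative, so it can be distributed over the two factors; the
  twisted weights then convolve like the original ones.\<close>

lemma fourier_conv_int:
  assumes "u summable_on UNIV" "v summable_on UNIV"
  shows "fourier (conv_int u v) t = fourier u t * fourier v t"
proof -
  have "((\<lambda>k. \<Sum>\<^sub>\<infinity>j. (of_real (u (k - j)) * cis (of_int (k - j) * t)) * (of_real (v j) * cis (of_int j * t)))
     has_sum fourier u t * fourier v t) UNIV"
    unfolding fourier_def by (rule convolution_has_sum(3)[OF abs_summable_fourier abs_summable_fourier]) fact+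
  moreover have "(\<Sum>\<^sub>\<infinity>j. (of_real (u (k - j)) * cis (of_int (k - j) * t)) * (of_real (v j) * cis (of_int j * t)))
     = of_real (conv_int u v k) * cis (of_int k * t)" for k
  proof -
    have "((\<lambda>j. complex_of_real (u (k - j) * v j) * cis (of_int k * t)) has_sum
        of_real (conv_int u v k) * cis (of_int k * t)) UNIV"
      unfolding conv_int_def
      by (intro has_sum_cmult_left has_sum_of_real has_sum_infsum conv_int_inner_summable assms)
    moreover have "(of_real (u (k - j)) * cis (of_int (k - j) * t)) * (of_real (v j) * cis (of_int j * t))
        = complex_of_real (u (k - j) * v j) * cis (of_int k * t)" for j
    proof -
      have "cis (of_int k * t) = cis (of_int (k - j) * t) * cis (of_int j * t)"
        by (simp add: cis_mult algebra_simps)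
      thus ?thesis by simp
    qed
    ultimately show ?thesis by (simp only: infsumI)
  qed
  ultimately have "((\<lambda>k. of_real (conv_int u v k) * cis (of_int k * t)) has_sum fourier u t * fourier v t) UNIV"
    by simp
  thus ?thesis unfolding fourier_def by (rule infsumI)
qed

lemma fourier_add:
  assumes "u summable_on UNIV" "v summable_on UNIV"
  shows "fourier (\<lambda>k. u k + v k) t = fourier u t + fourier v t"
proof -
  have "((\<lambda>k. of_real (u k + v k) * cis (of_int k * t)) has_sum (fourier u t + fourier v t)) UNIV"
    unfolding of_real_add distrib_right by (intro has_sum_add fourier_has_sum assms)
  thus ?thesis unfolding fourier_def[of "\<lambda>k. u k + v k"] by (rule infsumI)
qed

text \<open>Because \<open>k = (k - j) + j\<close>, \<open>mom\<close> is a derivation for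
  convolution. This is the product rule for transforms, obtained on the side of the weights without
  differentiating anything.\<close>

lemma mom_conv_int:
  assumes "u summable_on UNIV" "v summable_on UNIV" "mom u summable_on UNIV" "mom v summable_on UNIV"
  shows "mom (conv_int u v) = (\<lambda>k. conv_int (mom u) v k + conv_int u (mom v) k)"
proof
  fix k
  have "((\<lambda>j. mom u (k - j) * v j + u (k - j) * mom v j) has_sum
      (conv_int (mom u) v k + conv_int u (mom v) k)) UNIV"
    unfolding conv_int_def by (intro has_sum_add has_sum_infsum conv_int_inner_summable assms)
  moreover have "mom u (k - j) * v j + u (k - j) * mom v j = of_int k * (u (k - j) * v j)" for j
    by (simp add: mom_def algebra_simps)
  ultimately have "((\<lambda>j. of_int k * (u (k - j) * v j)) has_sum
      (conv_int (mom u) v k + conv_int u (mom v) k)) UNIV" by simp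
  moreover have "((\<lambda>j. of_int k * (u (k - j) * v j)) has_sum mom (conv_int u v) k) UNIV"
    unfolding mom_def conv_int_def by (intro has_sum_cmult_right has_sum_infsum conv_int_inner_summable assms)
  ultimately show "mom (conv_int u v) k = conv_int (mom u) v k + conv_int u (mom v) k"
    by (rule has_sum_unique[symmetric])
qed

lemma mom_add: "mom (\<lambda>k. u k + v k) = (\<lambda>k. mom u k + mom v k)"
  by (rule ext) (simp add: mom_def distrib_left)

text \<open>With \<open>c = 1\<close> this compares the transform with its value at 0, with
  \<open>c = 0\<close> it is the trivial bound; both are applied to moments.\<close>

lemma norm_fourier_le:
  assumes "(g has_sum S) UNIV" "\<And>k. norm (complex_of_real (w k) * cis (of_int k * t) - of_real (w k) * c) \<le> g k"
    "w summable_on UNIV"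
  shows "norm (fourier w t - of_real (infsum w UNIV) * c) \<le> S"
proof -
  have "((\<lambda>k. complex_of_real (w k) * cis (of_int k * t) - of_real (w k) * c) has_sum
      (fourier w t - of_real (infsum w UNIV) * c)) UNIV"
    unfolding diff_conv_add_uminus
    by (intro has_sum_add has_sum_uminusI fourier_has_sum has_sum_cmult_left has_sum_of_real has_sum_infsum assms)
  thus ?thesis using assms(1,2) by (rule norm_infsum_le)
qed

section \<open>Fourier inversion on [-pi, pi]\<close>

lemma has_integral_cis:
  "((\<lambda>t. cis (of_int m * t)) has_integral (if m = 0 then complex_of_real (2 * pi) else 0)) {- pi..pi}"
proof (cases "m = 0")
  case True
  have "((\<lambda>t. 1::complex) has_integral of_real (2 * pi)) {- pi..pi}"
    using has_integral_const_real[of "1::complex" "-pi" pi] by (simp add: scaleR_conv_of_real)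
  thus ?thesis using True by simp
next
  case False
  have "((\<lambda>t. cis (of_int m * t)) has_integral
      (cis (of_int m * pi) / (\<i> * of_int m) - cis (of_int m * (- pi)) / (\<i> * of_int m))) {- pi..pi}"
  proof (rule fundamental_theorem_of_calculus)
    fix t
    have "((\<lambda>z. exp (\<i> * of_int m * z) / (\<i> * of_int m)) has_field_derivative exp (\<i> * of_int m * of_real t)) (at (of_real t))"
      using False by (auto intro!: derivative_eq_intros)
    from has_vector_derivative_real_field[OF this]
    show "((\<lambda>t. cis (of_int m * t) / (\<i> * of_int m)) has_vector_derivative cis (of_int m * t)) (at t within {- pi..pi})"
      by (simp add: cis_conv_exp mult.assoc)
  qed auto
  moreover have "cis (of_int m * pi) = cis (of_int m * (- pi))"
  proof -
    have "cis (of_int m * pi) = cis (of_int m * (- pi)) * cis (2 * pi * of_int m)"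
      by (simp add: cis_mult algebra_simps)
    thus ?thesis by (simp add: cis_multiple_2pi)
  qed
  ultimately show ?thesis using False by simp
qed

text \<open>This kernel serves as majorant for Gaussians: it has an elementary antiderivative, and
  its integral has the same order 1 / sqrt b.\<close>

lemma has_integral_cauchy_kernel:
  assumes "0 < b"
  shows "((\<lambda>t. 1 / (1 + b * t\<^sup>2)) has_integral 2 * arctan (sqrt b * pi) / sqrt b) {- pi..pi}"
proof -
  define s where "s = sqrt b"
  have s: "s \<noteq> 0" "b = s\<^sup>2" using assms by (auto simp: s_def)
  have "((\<lambda>t. 1 / (1 + b * t\<^sup>2)) has_integral (arctan (s * pi) / s - arctan (s * (- pi)) / s)) {- pi..pi}"
  proof (rule fundamental_theorem_of_calculus)
    fix t
    have "((\<lambda>t. arctan (s * t) / s) has_real_derivative inverse (1 + (s * t)\<^sup>2)) (at t within {- pi..pi})"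
      using s(1) by (auto intro!: derivative_eq_intros)
    thus "((\<lambda>t. arctan (s * t) / s) has_vector_derivative 1 / (1 + b * t\<^sup>2)) (at t within {- pi..pi})"
      by (simp add: has_real_derivative_iff_has_vector_derivative[symmetric] s(2) power_mult_distrib inverse_eq_divide)
  qed auto
  thus ?thesis by (simp add: arctan_minus s_def)
qed

text \<open>Inversion is exact for a finite trigonometric polynomial that approximates the transform
  uniformly, and the error \<open>2 * pi * \<epsilon>\<close> disappears in the limit. Only the
  polynomial and the majorant are integrated, never the transform. Bounding arctan by pi / 2 yields
  the factor 2 on the left.\<close>

lemma coefficient_bound:
  assumes w: "w summable_on UNIV" and "0 \<le> \<kappa>" "0 < b"
    and bound: "\<And>t. \<bar>t\<bar> \<le> pi \<Longrightarrow> norm (fourier w t) \<le> \<kappa> / (1 + b * t\<^sup>2)"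
  shows "2 * \<bar>w k\<bar> \<le> \<kappa> / sqrt b"
proof -
  have wa: "(\<lambda>k. \<bar>w k\<bar>) summable_on UNIV" using w summable_on_iff_abs_summable_on_real[of w UNIV] by simp
  have "2 * pi * \<bar>w k\<bar> \<le> \<kappa> * pi / sqrt b + 2 * pi * \<epsilon>" if "0 < \<epsilon>" for \<epsilon>
  proof -
    have "(sum (\<lambda>k. \<bar>w k\<bar>) \<longlongrightarrow> (\<Sum>\<^sub>\<infinity>k. \<bar>w k\<bar>)) (finite_subsets_at_top UNIV)"
      using has_sum_infsum[OF wa] by (simp add: has_sum_def)
    hence "\<forall>\<^sub>F F in finite_subsets_at_top UNIV. dist (\<Sum>k\<in>F. \<bar>w k\<bar>) (\<Sum>\<^sub>\<infinity>k. \<bar>w k\<bar>) < \<epsilon>"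
      using that by (rule tendstoD)
    then obtain F0 where "finite F0" and F0: "\<And>F. finite F \<Longrightarrow> F0 \<subseteq> F \<Longrightarrow> dist (\<Sum>k\<in>F. \<bar>w k\<bar>) (\<Sum>\<^sub>\<infinity>k. \<bar>w k\<bar>) < \<epsilon>"
      unfolding eventually_finite_subsets_at_top by auto
    \<comment> \<open>Including \<open>k\<close> ensures that integration against the conjugate
      character returns \<open>w k\<close>.\<close>
    define F where "F = insert k F0"
    have F: "finite F" "k \<in> F" "dist (\<Sum>k\<in>F. \<bar>w k\<bar>) (\<Sum>\<^sub>\<infinity>k. \<bar>w k\<bar>) < \<epsilon>"
      using \<open>finite F0\<close> by (auto simp: F_def intro!: F0)
    have split: "UNIV = F \<union> (- F)" by auto
    define p where "p t = (\<Sum>j\<in>F. of_real (w j) * cis (of_int j * t))" for t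
    have "(\<Sum>\<^sub>\<infinity>k. \<bar>w k\<bar>) = (\<Sum>k\<in>F. \<bar>w k\<bar>) + (\<Sum>\<^sub>\<infinity>k\<in>-F. \<bar>w k\<bar>)"
      using infsum_Un_disjoint[of "\<lambda>k. \<bar>w k\<bar>" F "- F"] F(1) summable_on_subset[OF wa] by (simp add: split[symmetric])
    hence tail: "(\<Sum>\<^sub>\<infinity>k\<in>-F. \<bar>w k\<bar>) \<le> \<epsilon>" using F(3) by (simp add: dist_real_def)
    have approx: "norm (p t) \<le> norm (fourier w t) + \<epsilon>" for t
    proof -
      let ?h = "\<lambda>k. complex_of_real (w k) * cis (of_int k * t)"
      have hs: "?h abs_summable_on A" for A using abs_summable_fourier[OF w] by (rule summable_on_subset) auto
      have "fourier w t = p t + infsum ?h (- F)"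
        unfolding fourier_def p_def
        using infsum_Un_disjoint[of ?h F "- F"] F(1) abs_summable_summable[OF hs] by (simp add: split[symmetric])
      moreover have "norm (infsum ?h (- F)) \<le> (\<Sum>\<^sub>\<infinity>k\<in>-F. \<bar>w k\<bar>)"
        using norm_infsum_bound[OF hs, of "- F"] by (simp add: norm_mult)
      ultimately show ?thesis using tail norm_triangle_ineq4[of "fourier w t" "infsum ?h (- F)"] by simp
    qed
    have 1: "((\<lambda>t. p t * cis (- of_int k * t)) has_integral (2 * pi * w k)) {- pi..pi}"
    proof -
      have "((\<lambda>t. \<Sum>j\<in>F. of_real (w j) * cis (of_int (j - k) * t)) has_integral
          (\<Sum>j\<in>F. of_real (w j) * (if j - k = 0 then complex_of_real (2 * pi) else 0))) {- pi..pi}"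
        by (intro has_integral_sum F has_integral_mult_right has_integral_cis)
      moreover have "(\<Sum>j\<in>F. of_real (w j) * (if j - k = 0 then complex_of_real (2 * pi) else 0)) = 2 * pi * w k"
      proof -
        have "of_real (w j) * (if j - k = 0 then complex_of_real (2 * pi) else 0)
            = (if j = k then of_real (2 * pi * w k) else 0)" for j by simp
        thus ?thesis using F by (simp only: sum.delta) simp
      qed
      moreover have "(\<Sum>j\<in>F. of_real (w j) * cis (of_int (j - k) * t)) = p t * cis (- of_int k * t)" for t
      proof -
        have "cis (of_int (j - k) * t) = cis (of_int j * t) * cis (- of_int k * t)" for j
          unfolding cis_mult by (simp add: left_diff_distrib)
        thus ?thesis unfolding p_def sum_distrib_right by (simp only: mult.assoc)
      qed
      ultimately show ?thesis by (simp only:)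
    qed
    have 2: "((\<lambda>t. \<kappa> * (1 / (1 + b * t\<^sup>2)) + \<epsilon>) has_integral
        (\<kappa> * (2 * arctan (sqrt b * pi) / sqrt b) + 2 * pi * \<epsilon>)) {- pi..pi}"
      using has_integral_const_real[of \<epsilon> "-pi" pi]
      by (intro has_integral_add has_integral_mult_right has_integral_cauchy_kernel assms) simp
    have "norm (integral {- pi..pi} (\<lambda>t. p t * cis (- of_int k * t)))
        \<le> integral {- pi..pi} (\<lambda>t. \<kappa> * (1 / (1 + b * t\<^sup>2)) + \<epsilon>)"
    proof (rule integral_norm_bound_integral)
      fix t :: real assume "t \<in> {- pi..pi}"
      hence "\<bar>t\<bar> \<le> pi" by auto
      from bound[OF this] show "norm (p t * cis (- of_int k * t)) \<le> \<kappa> * (1 / (1 + b * t\<^sup>2)) + \<epsilon>"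
        using approx[of t] by (simp add: norm_mult)
    qed (use 1 2 in \<open>auto simp: integrable_on_def\<close>)
    also have "\<dots> = \<kappa> * (2 * arctan (sqrt b * pi) / sqrt b) + 2 * pi * \<epsilon>" using 2 by (rule integral_unique)
    also have "\<dots> \<le> \<kappa> * (pi / sqrt b) + 2 * pi * \<epsilon>"
      using arctan_ubound[of "sqrt b * pi"] assms
      by (intro add_mono mult_left_mono divide_right_mono) auto
    finally show ?thesis using integral_unique[OF 1] by (simp add: norm_mult)
  qed
  note eps = this
  have "2 * pi * \<bar>w k\<bar> \<le> \<kappa> * pi / sqrt b"
  proof (rule field_le_epsilon)
    fix e :: real assume "0 < e"
    thus "2 * pi * \<bar>w k\<bar> \<le> \<kappa> * pi / sqrt b + e" using eps[of "e / (2 * pi)"] by simp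
  qed
  hence "pi * (2 * \<bar>w k\<bar>) \<le> pi * (\<kappa> / sqrt b)" by (simp add: algebra_simps)
  thus ?thesis by (simp only: mult_le_cancel_left_pos[OF pi_gt_zero])
qed

section \<open>A Gaussian bound from the coset condition\<close>

lemma norm_cis_minus_1: "(norm (cis x - 1))\<^sup>2 = 2 - 2 * cos x"
proof -
  have "(norm (cis x - 1))\<^sup>2 = (cos x - 1)\<^sup>2 + (sin x)\<^sup>2" by (simp add: cmod_power2)
  also have "\<dots> = ((sin x)\<^sup>2 + (cos x)\<^sup>2) + 1 - 2 * cos x" by (simp add: power2_eq_square algebra_simps)
  also have "\<dots> = 2 - 2 * cos x" by simp
  finally show ?thesis .
qed

lemma norm_cis_minus_1_le: "norm (cis x - 1) \<le> \<bar>x\<bar>"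
  using iexp_approx1[of x 0] by (simp add: cis_conv_exp)

text \<open>The first-order Taylor expansion handles \<open>\<bar>t\<bar> \<le> 1\<close>. Beyond
  that, monotonicity of the cosine keeps the distance at least its value at 1, which is at least 1 /
  2; hence the coarse constant \<open>2 * pi\<close>.\<close>

lemma norm_cis_minus_1_ge:
  assumes "\<bar>t\<bar> \<le> pi"
  shows "\<bar>t\<bar> \<le> 2 * pi * norm (cis t - 1)"
proof -
  have small: "\<bar>x\<bar> \<le> 2 * norm (cis x - 1)" if "\<bar>x\<bar> \<le> 1" for x
  proof -
    have "norm (cis x - (1 + \<i> * x)) \<le> x\<^sup>2 / 2"
      using iexp_approx1[of x 1] by (simp add: cis_conv_exp numeral_2_eq_2)
    moreover have "\<bar>x\<bar> = norm (\<i> * complex_of_real x)" by (simp add: norm_mult)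
    moreover have "norm (\<i> * complex_of_real x) \<le> norm (cis x - 1) + norm (cis x - (1 + \<i> * x))"
      using norm_triangle_ineq4[of "cis x - 1" "cis x - (1 + \<i> * x)"] by simp
    moreover have "x\<^sup>2 \<le> \<bar>x\<bar>"
      using that mult_left_mono[OF that, of "\<bar>x\<bar>"] by (simp add: power2_eq_square)
    ultimately show ?thesis by simp
  qed
  show ?thesis
  proof (cases "\<bar>t\<bar> \<le> 1")
    case True
    have "2 * norm (cis t - 1) \<le> 2 * pi * norm (cis t - 1)"
      using pi_gt3 by (intro mult_right_mono) auto
    thus ?thesis using small[OF True] by linarith
  next
    case False
    have "cos \<bar>t\<bar> \<le> cos 1" using False assms by (intro cos_monotone_0_pi_le) auto
    hence "(norm (cis 1 - 1))\<^sup>2 \<le> (norm (cis t - 1))\<^sup>2" by (simp add: norm_cis_minus_1)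
    hence "norm (cis 1 - 1) \<le> norm (cis t - 1)" by (rule power2_le_imp_le) simp
    hence "1 \<le> 2 * norm (cis t - 1)" using small[of 1] by simp
    hence "pi * 1 \<le> pi * (2 * norm (cis t - 1))" by (intro mult_left_mono) auto
    also have "\<dots> = 2 * pi * norm (cis t - 1)" by simp
    finally have "pi \<le> 2 * pi * norm (cis t - 1)" by (simp only: mult_1_right)
    thus ?thesis using assms by linarith
  qed
qed

lemma norm_cis_add_minus_1: "norm (cis (x + y) - 1) \<le> norm (cis x - 1) + norm (cis y - 1)"
proof -
  have "cis (x + y) - 1 = cis x * (cis y - 1) + (cis x - 1)" by (simp add: cis_mult[symmetric] algebra_simps)
  hence "norm (cis (x + y) - 1) \<le> norm (cis x * (cis y - 1)) + norm (cis x - 1)" by (metis norm_triangle_ineq)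
  thus ?thesis by (simp add: norm_mult)
qed

lemma norm_cis_neg_minus_1: "norm (cis (- x) - 1) = norm (cis x - 1)"
proof -
  have "(norm (cis (- x) - 1))\<^sup>2 = (norm (cis x - 1))\<^sup>2" unfolding norm_cis_minus_1 by simp
  thus ?thesis by (rule power2_eq_imp_eq) auto
qed

lemma norm_cis_of_int_mult: "norm (cis (of_int m * x) - 1) \<le> \<bar>of_int m\<bar> * norm (cis x - 1)"
proof -
  have nat: "norm (cis (real n * x) - 1) \<le> real n * norm (cis x - 1)" for n
  proof (induction n)
    case (Suc n)
    have "norm (cis (real n * x + x) - 1) \<le> norm (cis (real n * x) - 1) + norm (cis x - 1)"
      by (rule norm_cis_add_minus_1)
    with Suc show ?case by (simp add: algebra_simps)
  qed simp
  show ?thesis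
  proof (cases "0 \<le> m")
    case True
    thus ?thesis using nat[of "nat m"] by simp
  next
    case False
    thus ?thesis using nat[of "nat (- m)"] norm_cis_neg_minus_1[of "of_int m * x"] by simp
  qed
qed

text \<open>By Bezout the gcd is an integer combination of the elements, and the distance of
  \<open>cis\<close> to 1 is subadditive. The coefficients depend on \<open>D\<close> alone, so
  \<open>U\<close> is uniform in \<open>t\<close> and \<open>s\<close>.\<close>

lemma norm_cis_Gcd_bound:
  fixes D :: "int set"
  assumes "finite D"
  shows "\<exists>U\<ge>0. \<forall>t s. (\<forall>d\<in>D. norm (cis (of_int d * t) - 1) \<le> s) \<longrightarrow> norm (cis (of_int (Gcd D) * t) - 1) \<le> U * s"
  using assms
proof (induction D rule: finite_induct)
  case (insert d D)
  then obtain U where U: "U \<ge> 0" "\<And>t s. (\<forall>d\<in>D. norm (cis (of_int d * t) - 1) \<le> s) \<Longrightarrow> norm (cis (of_int (Gcd D) * t) - 1) \<le> U * s"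
    by blast
  obtain p q where pq: "p * d + q * Gcd D = gcd d (Gcd D)" using bezout_int by blast
  have "norm (cis (of_int (Gcd (insert d D)) * t) - 1) \<le> (\<bar>of_int p\<bar> + \<bar>of_int q\<bar> * U) * s"
    if s: "\<forall>d\<in>insert d D. norm (cis (of_int d * t) - 1) \<le> s" for t s
  proof -
    have "of_int (Gcd (insert d D)) * t = of_int p * (of_int d * t) + of_int q * (of_int (Gcd D) * t)"
      unfolding Gcd_insert pq[symmetric] by (simp add: algebra_simps)
    hence "norm (cis (of_int (Gcd (insert d D)) * t) - 1)
        \<le> norm (cis (of_int p * (of_int d * t)) - 1) + norm (cis (of_int q * (of_int (Gcd D) * t)) - 1)"
      using norm_cis_add_minus_1 by simp
    also have "\<dots> \<le> \<bar>of_int p\<bar> * norm (cis (of_int d * t) - 1) + \<bar>of_int q\<bar> * norm (cis (of_int (Gcd D) * t) - 1)"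
      by (intro add_mono norm_cis_of_int_mult)
    also have "\<dots> \<le> \<bar>of_int p\<bar> * s + \<bar>of_int q\<bar> * (U * s)"
      using s U(2)[of t s] by (intro add_mono mult_left_mono) auto
    finally show ?thesis by (simp add: algebra_simps)
  qed
  thus ?case using U(1) by (intro exI[of _ "\<bar>of_int p\<bar> + \<bar>of_int q\<bar> * U"]) auto
qed (auto intro: exI[of _ 0])

text \<open>A finite \<open>I\<close> has finitely many subsets, so one constant serves them all.
  This makes the Gaussian rate independent of the individual measure.\<close>

lemma norm_cis_coprime_bound:
  fixes I :: "int set"
  assumes I: "finite I"
  shows "\<exists>U\<ge>0. \<forall>D\<subseteq>I. Gcd D = 1 \<longrightarrow> (\<forall>t. \<forall>s\<ge>0. (\<forall>d\<in>D. norm (cis (of_int d * t) - 1) \<le> s) \<longrightarrow> norm (cis t - 1) \<le> U * s)"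
proof -
  have "\<forall>D\<in>Pow I. \<exists>U\<ge>0. \<forall>t s. (\<forall>d\<in>D. norm (cis (of_int d * t) - 1) \<le> s) \<longrightarrow> norm (cis (of_int (Gcd D) * t) - 1) \<le> U * s"
    using I by (auto intro!: norm_cis_Gcd_bound intro: finite_subset)
  then obtain U where U: "\<And>D. D \<subseteq> I \<Longrightarrow> 0 \<le> U D"
    "\<And>D t s. D \<subseteq> I \<Longrightarrow> (\<forall>d\<in>D. norm (cis (of_int d * t) - 1) \<le> s) \<Longrightarrow> norm (cis (of_int (Gcd D) * t) - 1) \<le> U D * s"
    by (metis PowI)
  show ?thesis
  proof (intro exI[of _ "\<Sum>D\<in>Pow I. U D"] conjI allI impI)
    show "0 \<le> (\<Sum>D\<in>Pow I. U D)" using U(1) by (intro sum_nonneg) auto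
    fix D t and s :: real
    assume D: "D \<subseteq> I" "Gcd D = 1" and s: "0 \<le> s" "\<forall>d\<in>D. norm (cis (of_int d * t) - 1) \<le> s"
    have "norm (cis t - 1) \<le> U D * s" using U(2)[OF D(1) s(2)] D(2) by simp
    also have "U D \<le> (\<Sum>D\<in>Pow I. U D)" using I D(1) U(1) by (intro member_le_sum) auto
    finally show "norm (cis t - 1) \<le> (\<Sum>D\<in>Pow I. U D) * s" using s(1) by (simp add: mult_right_mono)
  qed
qed

section \<open>Measures with bounded first moment and small coset masses\<close>

lemma mass_interval_ge:
  assumes \<nu>: "is_prob_int \<nu>" "(\<lambda>k. \<bar>real_of_int k\<bar> * \<nu> k) summable_on UNIV" "m1_int \<nu> \<le> a" and R: "0 < R"
  shows "1 - a / of_int R \<le> (\<Sum>k\<in>{-R..R}. \<nu> k)"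
proof -
  have nn: "0 \<le> \<nu> k" for k using \<nu>(1) by (simp add: is_prob_int_def)
  have 1: "(\<nu> has_sum 1) UNIV" using \<nu>(1) by (simp add: is_prob_int_def)
  have "((\<lambda>k. if k \<in> {-R..R} then \<nu> k else 0) has_sum (\<Sum>k\<in>{-R..R}. \<nu> k)) UNIV"
    by (rule has_sum_finite_neutralI[of "{-R..R}"]) auto
  hence "((\<lambda>k. (if k \<in> {-R..R} then \<nu> k else 0) + \<bar>real_of_int k\<bar> * \<nu> k * (1 / of_int R)) has_sum
      ((\<Sum>k\<in>{-R..R}. \<nu> k) + m1_int \<nu> * (1 / of_int R))) UNIV"
    unfolding m1_int_def
    by (intro has_sum_add has_sum_cmult_left has_sum_infsum \<nu>(2))
  moreover have "\<nu> k \<le> (if k \<in> {-R..R} then \<nu> k else 0) + \<bar>real_of_int k\<bar> * \<nu> k * (1 / of_int R)" for k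
  proof (cases "k \<in> {-R..R}")
    case True thus ?thesis using nn[of k] R by simp
  next
    case False
    hence "1 \<le> \<bar>real_of_int k\<bar> / of_int R" using R by (simp add: divide_simps) linarith
    hence "\<nu> k \<le> \<bar>real_of_int k\<bar> * \<nu> k * (1 / of_int R)"
      using mult_right_mono[OF _ nn[of k], of 1 "\<bar>real_of_int k\<bar> / of_int R"] by (simp add: mult_ac)
    thus ?thesis using False by (simp only: if_False add_0_left)
  qed
  ultimately have "1 \<le> (\<Sum>k\<in>{-R..R}. \<nu> k) + m1_int \<nu> * (1 / of_int R)"
    using has_sum_mono[OF 1] by blast
  moreover have "m1_int \<nu> * (1 / of_int R) \<le> a * (1 / of_int R)" using R \<nu>(3) by (intro mult_right_mono) auto
  ultimately show ?thesis by simp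
qed

text \<open>Rotating by the phase \<open>w\<close> of the transform makes it real and nonnegative;
  then \<open>1 - norm (fourier \<nu> t)\<close> is exactly the \<open>\<nu>\<close>-average of half
  the squared distance from \<open>cis (of_int k * t)\<close> to \<open>w\<close>. Restriction to
  \<open>I\<close> gives the inequality.\<close>

lemma one_minus_norm_fourier_ge:
  assumes \<nu>: "is_prob_int \<nu>"
  obtains w where "norm w = 1" and "\<And>I s. finite I \<Longrightarrow> 0 \<le> s \<Longrightarrow> (\<And>k. k \<in> I \<Longrightarrow> s \<le> norm (cis (of_int k * t) - w)) \<Longrightarrow>
      s\<^sup>2 / 2 * (\<Sum>k\<in>I. \<nu> k) \<le> 1 - norm (fourier \<nu> t)"
proof -
  have nn: "0 \<le> \<nu> k" for k using \<nu> by (simp add: is_prob_int_def)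
  have 1: "(\<nu> has_sum 1) UNIV" using \<nu> by (simp add: is_prob_int_def)
  have sm: "\<nu> summable_on UNIV" using 1 by (rule has_sum_imp_summable)
  \<comment> \<open>For a vanishing transform any unit vector works, but \<open>sgn 0\<close> is not
    one.\<close>
  define w where "w = (if fourier \<nu> t = 0 then 1 else sgn (fourier \<nu> t))"
  have w: "norm w = 1" by (simp add: w_def norm_sgn)
  have "fourier \<nu> t * cnj w = of_real (norm (fourier \<nu> t))"
    by (simp add: w_def sgn_eq complex_norm_square[symmetric] power2_eq_square divide_simps)
  moreover have "((\<lambda>k. complex_of_real (\<nu> k) * cis (of_int k * t) * cnj w) has_sum (fourier \<nu> t * cnj w)) UNIV"
    by (intro has_sum_cmult_left fourier_has_sum sm)
  ultimately have "((\<lambda>k. Re (complex_of_real (\<nu> k) * cis (of_int k * t) * cnj w)) has_sum norm (fourier \<nu> t)) UNIV"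
    using has_sum_Re by fastforce
  hence "((\<lambda>k. \<nu> k + - Re (complex_of_real (\<nu> k) * cis (of_int k * t) * cnj w)) has_sum (1 + - norm (fourier \<nu> t))) UNIV"
    by (intro has_sum_add has_sum_uminusI 1)
  moreover have "\<nu> k + - Re (complex_of_real (\<nu> k) * cis (of_int k * t) * cnj w) = \<nu> k * ((norm (cis (of_int k * t) - w))\<^sup>2 / 2)" for k
  proof -
    define z where "z = cis (of_int k * t)"
    have z: "norm z = 1" by (simp add: z_def)
    have "(norm (z - w))\<^sup>2 = (norm z)\<^sup>2 + (norm w)\<^sup>2 - 2 * Re (z * cnj w)"
      unfolding cmod_power2 by (simp add: power2_eq_square algebra_simps)
    hence "Re (z * cnj w) = 1 - (norm (z - w))\<^sup>2 / 2" unfolding z w power_one by linarith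
    moreover have "Re (complex_of_real (\<nu> k) * z * cnj w) = \<nu> k * Re (z * cnj w)"
      by (simp add: mult.assoc)
    ultimately have "Re (complex_of_real (\<nu> k) * z * cnj w) = \<nu> k * (1 - (norm (z - w))\<^sup>2 / 2)" by (simp only:)
    thus ?thesis unfolding z_def[symmetric] by (simp only:) (simp add: algebra_simps)
  qed
  ultimately have hs: "((\<lambda>k. \<nu> k * ((norm (cis (of_int k * t) - w))\<^sup>2 / 2)) has_sum (1 - norm (fourier \<nu> t))) UNIV"
    by (simp only: diff_conv_add_uminus)
  show thesis
  proof (rule that[OF w])
    fix I and s :: real assume I: "finite I" "0 \<le> s" "\<And>k. k \<in> I \<Longrightarrow> s \<le> norm (cis (of_int k * t) - w)"
    have "s\<^sup>2 / 2 * (\<Sum>k\<in>I. \<nu> k) = (\<Sum>k\<in>I. \<nu> k * (s\<^sup>2 / 2))" unfolding sum_distrib_left by (rule sum.cong[OF refl mult.commute])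
    also have "\<dots> \<le> (\<Sum>k\<in>I. \<nu> k * ((norm (cis (of_int k * t) - w))\<^sup>2 / 2))"
      using I nn by (intro sum_mono mult_left_mono divide_right_mono power_mono) auto
    also have "\<dots> \<le> 1 - norm (fourier \<nu> t)"
    proof (rule has_sum_mono2[OF has_sum_finite[OF I(1)] hs])
    qed (use nn in auto)
    finally show "s\<^sup>2 / 2 * (\<Sum>k\<in>I. \<nu> k) \<le> 1 - norm (fourier \<nu> t)" .
  qed
qed

lemma sum_le_coset_mass:
  assumes "is_prob_int \<nu>" "finite G" "G \<subseteq> {k. \<exists>j. k = \<beta> * j + r}"
  shows "(\<Sum>k\<in>G. \<nu> k) \<le> coset_mass \<nu> \<beta> r"
proof -
  have nn: "0 \<le> \<nu> k" for k using assms by (simp add: is_prob_int_def)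
  have sm: "\<nu> summable_on A" for A
    using assms(1) by (auto simp: is_prob_int_def intro: summable_on_subset[of _ UNIV] has_sum_imp_summable)
  have "(\<Sum>k\<in>G. \<nu> k) = infsum \<nu> G" using assms(2) by simp
  also have "\<dots> \<le> coset_mass \<nu> \<beta> r"
    unfolding coset_mass_def by (rule infsum_mono2[OF sm sm assms(3)]) (rule nn)
  finally show ?thesis .
qed

text \<open>If \<open>cis (k t)\<close> is close to a fixed unit vector for all \<open>k\<close> in a bounded set of mass more than \<open>\<rho>\<close>,
  then the coset condition forces the differences of these \<open>k\<close> to have gcd 1, so \<open>cis t\<close> is close to 1.\<close>
lemma fourier_gaussian_bound:
  assumes a: "0 < a" and \<rho>: "0 \<le> \<rho>" "\<rho> < 1"
  obtains c where "0 < c" and "\<And>\<nu> t. is_prob_int \<nu> \<Longrightarrow> (\<lambda>k. \<bar>real_of_int k\<bar> * \<nu> k) summable_on UNIV \<Longrightarrow>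
      m1_int \<nu> \<le> a \<Longrightarrow> (\<And>\<beta> r. \<beta> \<notin> {1, -1} \<Longrightarrow> coset_mass \<nu> \<beta> r \<le> \<rho>) \<Longrightarrow> \<bar>t\<bar> \<le> pi \<Longrightarrow>
      norm (fourier \<nu> t) \<le> exp (- c * t\<^sup>2)"
proof -
  \<comment> \<open>Half of the gap \<open>1 - \<rho>\<close> pays for the mass outside the
    interval, the other half remains for the points far from \<open>w\<close>.\<close>
  define \<delta> where "\<delta> = (1 - \<rho>) / 2"
  have \<delta>: "0 < \<delta>" using \<rho> by (simp add: \<delta>_def)
  define R where "R = \<lceil>a / \<delta>\<rceil> + 1"
  have aR: "a / \<delta> < of_int R" unfolding R_def by linarith
  have "0 < a / \<delta>" using a \<delta> by simp
  hence "0 < real_of_int R" using aR by linarith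
  hence R: "0 < R" "a / of_int R \<le> \<delta>" using aR \<delta> by (simp_all add: field_simps)
  obtain U where U: "0 \<le> U" "\<And>D t s. D \<subseteq> {-2*R..2*R} \<Longrightarrow> Gcd D = 1 \<Longrightarrow> 0 \<le> s \<Longrightarrow>
      (\<And>d. d \<in> D \<Longrightarrow> norm (cis (of_int d * t) - 1) \<le> s) \<Longrightarrow> norm (cis t - 1) \<le> U * s"
    using norm_cis_coprime_bound[of "{-2*R..2*R}"] by (auto 0 4)
  define V where "V = U + 1"
  have V: "0 < V" "U < V" using U(1) by (auto simp: V_def)
  \<comment> \<open>With \<open>s = e / (4 * V)\<close> and \<open>e\<close> at least
    \<open>\<bar>t\<bar> / (2 * pi)\<close>, this is the largest \<open>c\<close> for which the
    estimates give \<open>c * t^2 \<le> s^2 / 2 * \<delta>\<close>.\<close>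
  define c where "c = \<delta> / (128 * V\<^sup>2 * pi\<^sup>2)"
  show thesis
  proof (rule that[of c])
    show "0 < c" using \<delta> V by (simp add: c_def)
    fix \<nu> t
    assume \<nu>: "is_prob_int \<nu>" "(\<lambda>k. \<bar>real_of_int k\<bar> * \<nu> k) summable_on UNIV" "m1_int \<nu> \<le> a"
      and coset: "\<And>\<beta> r. \<beta> \<notin> {1, -1} \<Longrightarrow> coset_mass \<nu> \<beta> r \<le> \<rho>" and t: "\<bar>t\<bar> \<le> pi"
    obtain w where w: "norm w = 1" and
      key: "\<And>I s. finite I \<Longrightarrow> 0 \<le> s \<Longrightarrow> (\<And>k. k \<in> I \<Longrightarrow> s \<le> norm (cis (of_int k * t) - w)) \<Longrightarrow>
      s\<^sup>2 / 2 * (\<Sum>k\<in>I. \<nu> k) \<le> 1 - norm (fourier \<nu> t)"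
      using one_minus_norm_fourier_ge[OF \<nu>(1), of t] by blast
    define e where "e = norm (cis t - 1)"
    \<comment> \<open>Differences of points of \<open>G\<close> have distance at most
      \<open>2 * s\<close>, so gcd 1 would give \<open>e \<le> V * (2 * s) = e / 2\<close>.\<close>
    define s where "s = e / (4 * V)"
    have e0: "0 \<le> e" and s0: "0 \<le> s" using V by (auto simp: e_def s_def)
    \<comment> \<open>The strict inequality makes \<open>G\<close> empty when
      \<open>cis t = 1\<close>; a nonempty \<open>G\<close> therefore gives
      \<open>0 < e\<close>.\<close>
    define G where "G = {k\<in>{-R..R}. norm (cis (of_int k * t) - w) < s}"
    have GI: "G \<subseteq> {-R..R}" by (auto simp: G_def)
    hence Gf: "finite G" by (rule finite_subset) simp
    have "(\<Sum>k\<in>G. \<nu> k) \<le> \<rho>"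
    proof (cases "G = {}")
      case False
      then obtain k0 where k0: "k0 \<in> G" by blast
      have "0 < s" using k0 by (auto simp: G_def intro: le_less_trans[OF norm_ge_zero])
      hence e: "0 < e" using V by (simp add: s_def zero_less_divide_iff)
      define D where "D = (\<lambda>k. k - k0) ` G"
      have DI: "D \<subseteq> {-2*R..2*R}" 
      proof
        fix d assume "d \<in> D"
        then obtain k where "k \<in> G" "d = k - k0" by (auto simp: D_def)
        moreover have "k \<in> {-R..R}" "k0 \<in> {-R..R}" using calculation k0 GI by auto
        ultimately show "d \<in> {-2*R..2*R}" by simp
      qed
      have Ds: "norm (cis (of_int d * t) - 1) \<le> 2 * s" if "d \<in> D" for d
      proof -
        from that obtain k where k: "k \<in> G" "d = k - k0" by (auto simp: D_def)
        have "cis (of_int k * t) = cis (of_int k0 * t) * cis (of_int d * t)"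
          unfolding cis_mult k(2) by (simp add: left_diff_distrib)
        hence "norm (cis (of_int k * t) - cis (of_int k0 * t)) = norm (cis (of_int k0 * t) * (cis (of_int d * t) - 1))"
          by (simp add: algebra_simps)
        hence "norm (cis (of_int d * t) - 1) = norm ((cis (of_int k * t) - w) - (cis (of_int k0 * t) - w))"
          by (simp add: norm_mult)
        also have "\<dots> \<le> norm (cis (of_int k * t) - w) + norm (cis (of_int k0 * t) - w)" by (rule norm_triangle_ineq4)
        also have "\<dots> \<le> 2 * s" using k(1) k0 by (auto simp: G_def)
        finally show ?thesis .
      qed
      have "Gcd D \<noteq> 1"
      proof
        assume "Gcd D = 1"
        from U(2)[OF DI this _ Ds] have "e \<le> U * (2 * s)" using s0 by (simp add: e_def)
        also have "\<dots> \<le> V * (2 * s)" using V s0 by (intro mult_right_mono) auto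
        also have "\<dots> = e / 2" using V by (simp add: s_def)
        finally show False using e by simp
      qed
      moreover have "Gcd D \<noteq> -1" using Gcd_int_greater_eq_0[of D] by linarith
      \<comment> \<open>If \<open>G\<close> is a single point then \<open>Gcd D = 0\<close>, which
        is the case of modulus 0 in the coset condition.\<close>
      ultimately have "Gcd D \<notin> {1, -1}" by auto
      moreover have "G \<subseteq> {k. \<exists>j. k = Gcd D * j + k0}"
      proof
        fix k assume "k \<in> G"
        hence "Gcd D dvd k - k0" by (intro Gcd_dvd) (auto simp: D_def)
        then obtain j where "k - k0 = Gcd D * j" by (elim dvdE)
        thus "k \<in> {k. \<exists>j. k = Gcd D * j + k0}" by (auto intro!: exI[of _ j])
      qed
      ultimately show ?thesis using sum_le_coset_mass[OF \<nu>(1) Gf] coset by (meson order.trans)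
    qed (use \<rho> in simp)
    moreover have "(\<Sum>k\<in>{-R..R} - G. \<nu> k) = (\<Sum>k\<in>{-R..R}. \<nu> k) - (\<Sum>k\<in>G. \<nu> k)"
      by (rule sum_diff) (use GI Gf in auto)
    moreover have "2 * \<delta> = 1 - \<rho>" by (simp add: \<delta>_def)
    ultimately have "\<delta> \<le> (\<Sum>k\<in>{-R..R} - G. \<nu> k)"
      using mass_interval_ge[OF \<nu> R(1)] R(2) by linarith
    hence "s\<^sup>2 / 2 * \<delta> \<le> s\<^sup>2 / 2 * (\<Sum>k\<in>{-R..R} - G. \<nu> k)" by (intro mult_left_mono) auto
    also have "\<dots> \<le> 1 - norm (fourier \<nu> t)" by (rule key) (use s0 in \<open>auto simp: G_def\<close>)
    finally have 1: "norm (fourier \<nu> t) \<le> 1 - s\<^sup>2 / 2 * \<delta>" by simp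
    have "t\<^sup>2 \<le> (2 * pi * e)\<^sup>2"
      using norm_cis_minus_1_ge[OF t] by (simp add: e_def abs_le_square_iff[symmetric])
    hence "c * t\<^sup>2 \<le> c * (2 * pi * e)\<^sup>2" using \<open>0 < c\<close> by (intro mult_left_mono) auto
    also have "\<dots> = s\<^sup>2 / 2 * \<delta>" using V by (simp add: c_def s_def field_simps power2_eq_square)
    finally have "norm (fourier \<nu> t) \<le> 1 + - c * t\<^sup>2" using 1 by simp
    also have "\<dots> \<le> exp (- c * t\<^sup>2)" by (rule exp_ge_add_one_self)
    finally show "norm (fourier \<nu> t) \<le> exp (- c * t\<^sup>2)" .
  qed
qed

section \<open>Kernel bounds for convolution products\<close>

lemma conv_int_delta: "conv_int (\<lambda>k. if k = 0 then 1 else 0) \<nu> = \<nu>"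
proof
  fix k
  have "((\<lambda>j. (if k - j = 0 then 1 else 0) * \<nu> j) has_sum \<nu> k) UNIV"
    by (rule has_sum_finite_neutralI[of "{k}"]) auto
  thus "conv_int (\<lambda>k. if k = 0 then 1 else 0) \<nu> k = \<nu> k"
    unfolding conv_int_def by (rule infsumI)
qed

text \<open>Since the value at 0 is the convolution unit, one recursion covers all cases and
  inductions can begin at 0.\<close>

lemma conv_prod_Suc: "conv_prod \<nu> (Suc n) = conv_int (conv_prod \<nu> n) (\<nu> (Suc n))"
  by (cases n) (simp_all add: conv_int_delta)

text \<open>The first and second derivative of the Fourier transform of \<open>u\<close> are, up to powers of \<open>\<i>\<close>, the transforms
  of \<open>mom u\<close> and \<open>mom (mom u)\<close>; the parameter \<open>\<phi>\<close> stands for the accumulated second moment.\<close>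
definition fourier_bounds :: "real \<Rightarrow> real \<Rightarrow> nat \<Rightarrow> real \<Rightarrow> (int \<Rightarrow> real) \<Rightarrow> bool" where
  "fourier_bounds c K n \<phi> u \<longleftrightarrow> is_prob_int u \<and> mom u summable_on UNIV \<and> mom (mom u) summable_on UNIV \<and>
     (\<forall>t. \<bar>t\<bar> \<le> pi \<longrightarrow> norm (fourier u t) \<le> exp (- c * t\<^sup>2) ^ n \<and>
        norm (fourier (mom u) t) \<le> K * \<phi> * \<bar>t\<bar> * exp (- c * t\<^sup>2) ^ n \<and>
        norm (fourier (mom (mom u)) t) \<le> (K * \<phi> + K\<^sup>2 * \<phi>\<^sup>2 * t\<^sup>2) * exp (- c * t\<^sup>2) ^ n)"

text \<open>Mean zero says that the transform of \<open>mom \<nu>\<close> vanishes at 0; comparing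
  with that value gains the factor \<open>\<bar>t\<bar>\<close> at the price of one more
  moment.\<close>

lemma fourier_moment_bounds:
  assumes \<nu>: "is_prob_int \<nu>" and m: "mom \<nu> summable_on UNIV" "mean_int \<nu> = 0"
    and m2: "(\<lambda>k. (real_of_int k)\<^sup>2 * \<nu> k) summable_on UNIV"
  shows "mom (mom \<nu>) summable_on UNIV" "0 \<le> m2_int \<nu>"
    "norm (fourier (mom \<nu>) t) \<le> m2_int \<nu> * \<bar>t\<bar>" "norm (fourier (mom (mom \<nu>)) t) \<le> m2_int \<nu>"
proof -
  have nn: "0 \<le> \<nu> k" for k using \<nu> by (simp add: is_prob_int_def)
  have mm: "mom (mom \<nu>) = (\<lambda>k. (real_of_int k)\<^sup>2 * \<nu> k)" by (auto simp: mom_def power2_eq_square)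
  show mms: "mom (mom \<nu>) summable_on UNIV" using m2 by (simp add: mm)
  have hs: "((\<lambda>k. (real_of_int k)\<^sup>2 * \<nu> k) has_sum m2_int \<nu>) UNIV"
    unfolding m2_int_def by (rule has_sum_infsum[OF m2])
  show "0 \<le> m2_int \<nu>" unfolding m2_int_def by (rule infsum_nonneg) (simp add: nn)
  have "norm (fourier (mom \<nu>) t - of_real (infsum (mom \<nu>) UNIV) * 1) \<le> m2_int \<nu> * \<bar>t\<bar>"
  proof (rule norm_fourier_le[OF has_sum_cmult_left[OF hs] _ m(1)])
    fix k
    have "norm (complex_of_real (mom \<nu> k) * cis (of_int k * t) - of_real (mom \<nu> k) * 1)
        = \<bar>mom \<nu> k\<bar> * norm (cis (of_int k * t) - 1)"
      unfolding right_diff_distrib[symmetric] norm_mult by simp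
    also have "\<dots> \<le> \<bar>mom \<nu> k\<bar> * \<bar>of_int k * t\<bar>" by (intro mult_left_mono norm_cis_minus_1_le) auto
    also have "\<dots> = (real_of_int k)\<^sup>2 * \<nu> k * \<bar>t\<bar>"
    proof -
      define z where "z = \<bar>real_of_int k\<bar>"
      have "(real_of_int k)\<^sup>2 = z\<^sup>2" by (simp add: z_def)
      moreover have "\<bar>mom \<nu> k\<bar> * \<bar>of_int k * t\<bar> = z * \<nu> k * (z * \<bar>t\<bar>)"
        using nn[of k] by (simp add: mom_def abs_mult z_def)
      ultimately show ?thesis by (simp add: power2_eq_square)
    qed
    finally show "norm (complex_of_real (mom \<nu> k) * cis (of_int k * t) - of_real (mom \<nu> k) * 1) \<le> (real_of_int k)\<^sup>2 * \<nu> k * \<bar>t\<bar>" .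
  qed
  moreover have "infsum (mom \<nu>) UNIV = 0" using m(2) by (simp add: mean_int_def mom_def[abs_def])
  ultimately show "norm (fourier (mom \<nu>) t) \<le> m2_int \<nu> * \<bar>t\<bar>" by simp
  have "norm (fourier (mom (mom \<nu>)) t - of_real (infsum (mom (mom \<nu>)) UNIV) * 0) \<le> m2_int \<nu>"
    by (rule norm_fourier_le[OF hs _ mms]) (use nn in \<open>simp add: mm norm_mult abs_mult norm_power\<close>)
  thus "norm (fourier (mom (mom \<nu>)) t) \<le> m2_int \<nu>" by simp
qed

lemma fourier_bounds_0:
  assumes "0 \<le> K"
  shows "fourier_bounds c K 0 0 (\<lambda>k. if k = 0 then 1 else 0)"
proof -
  let ?d = "\<lambda>k::int. if k = 0 then 1 else (0::real)"
  have 1: "(?d has_sum 1) UNIV" by (rule has_sum_finite_neutralI[of "{0}"]) auto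
  have m: "mom ?d = (\<lambda>_. 0)" "mom (\<lambda>_. 0) = (\<lambda>_. 0)" by (auto simp: mom_def)
  have "fourier ?d t = 1" for t
    unfolding fourier_def by (rule infsumI, rule has_sum_finite_neutralI[of "{0}"]) auto
  moreover have "fourier (\<lambda>_. 0) t = 0" for t by (simp add: fourier_def)
  ultimately show ?thesis using 1 by (simp add: fourier_bounds_def m is_prob_int_def)
qed

text \<open>Terms in which \<open>\<nu>\<close> is differentiated lack one Gaussian factor. On
  [-pi, pi] the constant \<open>K\<close> restores it, and it multiplies only the increment of
  \<open>\<phi>\<close>, so it does not compound with \<open>n\<close>.\<close>

lemma fourier_bounds_Suc:
  assumes c: "0 < c" and K: "exp (c * pi\<^sup>2) \<le> K" and \<phi>: "0 \<le> \<phi>" and u: "fourier_bounds c K n \<phi> u"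
    and \<nu>: "is_prob_int \<nu>" "mom \<nu> summable_on UNIV" "mean_int \<nu> = 0"
      "(\<lambda>k. (real_of_int k)\<^sup>2 * \<nu> k) summable_on UNIV"
    and g: "\<And>t. \<bar>t\<bar> \<le> pi \<Longrightarrow> norm (fourier \<nu> t) \<le> exp (- c * t\<^sup>2)"
  shows "fourier_bounds c K (Suc n) (\<phi> + m2_int \<nu>) (conv_int u \<nu>)"
proof -
  note N = fourier_moment_bounds[OF \<nu>]
  have prob: "is_prob_int w \<Longrightarrow> w summable_on UNIV" for w
    by (auto simp: is_prob_int_def intro: has_sum_imp_summable)
  have us: "u summable_on UNIV" "mom u summable_on UNIV" "mom (mom u) summable_on UNIV"
    and up: "is_prob_int u"
    using u prob by (auto simp: fourier_bounds_def)
  have \<nu>s: "\<nu> summable_on UNIV" using \<nu>(1) by (rule prob)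
  note C = conv_int_summable[OF us(1) \<nu>s] conv_int_summable[OF us(2) \<nu>s] conv_int_summable[OF us(1) \<nu>(2)]
    conv_int_summable[OF us(3) \<nu>s] conv_int_summable[OF us(2) \<nu>(2)] conv_int_summable[OF us(1) N(1)]
  note m1 = mom_conv_int[OF us(1) \<nu>s us(2) \<nu>(2)]
  have m2: "mom (mom (conv_int u \<nu>)) = (\<lambda>k. (conv_int (mom (mom u)) \<nu> k + conv_int (mom u) (mom \<nu>) k)
      + (conv_int (mom u) (mom \<nu>) k + conv_int u (mom (mom \<nu>)) k))"
    unfolding m1 mom_add mom_conv_int[OF us(2) \<nu>s us(3) \<nu>(2)] mom_conv_int[OF us(1) \<nu>(2) us(2) N(1)] ..
  have "is_prob_int (conv_int u \<nu>)"
  proof -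
    have "infsum u UNIV = 1" "infsum \<nu> UNIV = 1" using up \<nu>(1) by (auto simp: is_prob_int_def infsumI)
    hence "(conv_int u \<nu> has_sum 1) UNIV" using conv_int_has_sum[OF us(1) \<nu>s] by simp
    moreover have "0 \<le> conv_int u \<nu> k" for k
      unfolding conv_int_def using up \<nu>(1) by (intro infsum_nonneg) (simp add: is_prob_int_def)
    ultimately show ?thesis by (simp add: is_prob_int_def)
  qed
  moreover have "mom (conv_int u \<nu>) summable_on UNIV" unfolding m1 by (intro summable_on_add C)
  moreover have "mom (mom (conv_int u \<nu>)) summable_on UNIV" unfolding m2 by (intro summable_on_add C)
  moreover have "norm (fourier (conv_int u \<nu>) t) \<le> exp (- c * t\<^sup>2) ^ Suc n \<and>
      norm (fourier (mom (conv_int u \<nu>)) t) \<le> K * (\<phi> + m2_int \<nu>) * \<bar>t\<bar> * exp (- c * t\<^sup>2) ^ Suc n \<and>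
      norm (fourier (mom (mom (conv_int u \<nu>))) t) \<le> (K * (\<phi> + m2_int \<nu>) + K\<^sup>2 * (\<phi> + m2_int \<nu>)\<^sup>2 * t\<^sup>2) * exp (- c * t\<^sup>2) ^ Suc n"
    if t: "\<bar>t\<bar> \<le> pi" for t
  proof -
    define E where "E = exp (- c * t\<^sup>2)"
    define m where "m = m2_int \<nu>"
    have m: "0 \<le> m" using N(2) by (simp add: m_def)
    have E: "0 < E" by (simp add: E_def)
    have K0: "0 < K" using K by (rule less_le_trans[OF exp_gt_zero])
    have "t\<^sup>2 \<le> pi\<^sup>2" using t by (metis abs_le_square_iff abs_of_nonneg pi_ge_zero)
    hence "1 \<le> exp (c * pi\<^sup>2) * E" using c unfolding E_def exp_add[symmetric] by simp
    also have "\<dots> \<le> K * E" using K E by (intro mult_right_mono) auto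
    finally have KE: "1 \<le> K * E" .
    have En: "E ^ n \<le> K * E ^ Suc n" using mult_right_mono[OF KE, of "E ^ n"] E by (simp add: algebra_simps)
    have a0: "norm (fourier u t) \<le> E ^ n" and a1: "norm (fourier (mom u) t) \<le> K * \<phi> * \<bar>t\<bar> * E ^ n"
      and a2: "norm (fourier (mom (mom u)) t) \<le> (K * \<phi> + K\<^sup>2 * \<phi>\<^sup>2 * t\<^sup>2) * E ^ n"
      using u t unfolding fourier_bounds_def E_def by blast+
    have b0: "norm (fourier \<nu> t) \<le> E" and b1: "norm (fourier (mom \<nu>) t) \<le> m * \<bar>t\<bar>" and b2: "norm (fourier (mom (mom \<nu>)) t) \<le> m"
      using g[OF t] N(3,4)[of t] by (simp_all add: E_def m_def)
    have p: "norm x * norm y \<le> X * Y" if "norm x \<le> X" "norm y \<le> Y" for x y :: complex and X Y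
      using that by (intro mult_mono) (auto intro: order_trans[OF norm_ge_zero])
    have r0: "norm (fourier (conv_int u \<nu>) t) \<le> E ^ Suc n"
      using p[OF a0 b0] by (simp add: fourier_conv_int us \<nu>s norm_mult mult.commute)
    have "norm (fourier (mom (conv_int u \<nu>)) t) \<le> norm (fourier (mom u) t) * norm (fourier \<nu> t) + norm (fourier u t) * norm (fourier (mom \<nu>) t)"
      unfolding m1 fourier_add[OF C(2,3)] fourier_conv_int[OF us(2) \<nu>s] fourier_conv_int[OF us(1) \<nu>(2)]
      by (metis norm_mult norm_triangle_ineq)
    also have "\<dots> \<le> K * \<phi> * \<bar>t\<bar> * E ^ n * E + E ^ n * (m * \<bar>t\<bar>)"
      by (intro add_mono p a0 a1 b0 b1)
    also have "E ^ n * (m * \<bar>t\<bar>) \<le> K * E ^ Suc n * (m * \<bar>t\<bar>)" using En m by (intro mult_right_mono) auto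
    also have "K * \<phi> * \<bar>t\<bar> * E ^ n * E + K * E ^ Suc n * (m * \<bar>t\<bar>) = K * (\<phi> + m) * \<bar>t\<bar> * E ^ Suc n"
      by (simp add: algebra_simps)
    finally have r1: "norm (fourier (mom (conv_int u \<nu>)) t) \<le> K * (\<phi> + m) * \<bar>t\<bar> * E ^ Suc n" by simp
    have "norm (fourier (mom (mom (conv_int u \<nu>))) t) \<le>
        (norm (fourier (mom (mom u)) t) * norm (fourier \<nu> t) + norm (fourier (mom u) t) * norm (fourier (mom \<nu>) t))
      + (norm (fourier (mom u) t) * norm (fourier (mom \<nu>) t) + norm (fourier u t) * norm (fourier (mom (mom \<nu>)) t))"
      unfolding m2 fourier_add[OF summable_on_add[OF C(4,5)] summable_on_add[OF C(5,6)]] fourier_add[OF C(4,5)] fourier_add[OF C(5,6)]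
        fourier_conv_int[OF us(3) \<nu>s] fourier_conv_int[OF us(2) \<nu>(2)] fourier_conv_int[OF us(1) N(1)] norm_mult[symmetric]
      by (intro norm_triangle_mono order_refl)
    also have "\<dots> \<le> ((K * \<phi> + K\<^sup>2 * \<phi>\<^sup>2 * t\<^sup>2) * E ^ n * E + K * \<phi> * \<bar>t\<bar> * E ^ n * (m * \<bar>t\<bar>))
        + (K * \<phi> * \<bar>t\<bar> * E ^ n * (m * \<bar>t\<bar>) + E ^ n * m)"
      by (intro add_mono p a0 a1 a2 b0 b1 b2)
    also have "\<dots> = (K * \<phi> + K\<^sup>2 * \<phi>\<^sup>2 * t\<^sup>2) * E ^ Suc n + E ^ n * (2 * K * \<phi> * m * t\<^sup>2 + m)"
    proof -
      define T where "T = \<bar>t\<bar>"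
      have t2: "t\<^sup>2 = T\<^sup>2" by (simp add: T_def)
      show ?thesis unfolding t2 T_def[symmetric] by (simp add: algebra_simps power2_eq_square)
    qed
    also have "E ^ n * (2 * K * \<phi> * m * t\<^sup>2 + m) \<le> K * E ^ Suc n * (2 * K * \<phi> * m * t\<^sup>2 + m)"
      using En m K0 \<phi> by (intro mult_right_mono) auto
    also have "(K * \<phi> + K\<^sup>2 * \<phi>\<^sup>2 * t\<^sup>2) * E ^ Suc n + K * E ^ Suc n * (2 * K * \<phi> * m * t\<^sup>2 + m)
       = (K * (\<phi> + m) + K\<^sup>2 * (\<phi>\<^sup>2 + 2 * \<phi> * m) * t\<^sup>2) * E ^ Suc n"
      by (simp add: algebra_simps power2_eq_square)
    \<comment> \<open>The cross terms complete the square up to the nonnegative square of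
      \<open>m\<close>, so the bound reproduces itself with \<open>\<phi> + m\<close>.\<close>
    also have "\<dots> \<le> (K * (\<phi> + m) + K\<^sup>2 * (\<phi> + m)\<^sup>2 * t\<^sup>2) * E ^ Suc n"
      using E m \<phi> K0 by (intro mult_right_mono add_mono mult_left_mono) (auto simp: power2_eq_square algebra_simps)
    finally have r2: "norm (fourier (mom (mom (conv_int u \<nu>))) t) \<le> (K * (\<phi> + m) + K\<^sup>2 * (\<phi> + m)\<^sup>2 * t\<^sup>2) * E ^ Suc n" by simp
    show ?thesis using r0 r1 r2 unfolding E_def m_def by blast
  qed
  ultimately show ?thesis unfolding fourier_bounds_def by blast
qed

section \<open>From transform bounds to pointwise kernel bounds\<close>

lemma fourier_shift:
  assumes "u summable_on UNIV"
  shows "(\<lambda>k. u (k + 1)) summable_on UNIV" "fourier (\<lambda>k. u (k + 1)) t = cis (- t) * fourier u t"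
proof -
  have bij: "bij_betw (\<lambda>k::int. k + 1) UNIV UNIV" by (rule bij_betwI[of _ _ _ "\<lambda>k. k - 1"]) auto
  show "(\<lambda>k. u (k + 1)) summable_on UNIV" using assms summable_on_reindex_bij_betw[OF bij, of u] by simp
  have "((\<lambda>k. cis (- t) * (of_real (u k) * cis (of_int k * t))) has_sum cis (- t) * fourier u t) UNIV"
    by (intro has_sum_cmult_right fourier_has_sum assms)
  hence "((\<lambda>k. cis (- t) * (of_real (u (k + 1)) * cis (of_int (k + 1) * t))) has_sum cis (- t) * fourier u t) UNIV"
    using has_sum_reindex_bij_betw[OF bij, of "\<lambda>k. cis (- t) * (of_real (u k) * cis (of_int k * t))"] by simp
  moreover have "cis (- t) * (of_real (u (k + 1)) * cis (of_int (k + 1) * t)) = of_real (u (k + 1)) * cis (of_int k * t)" for k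
  proof -
    have "cis (- t) * cis (of_int (k + 1) * t) = cis (of_int k * t)"
      unfolding cis_mult by (simp add: algebra_simps)
    thus ?thesis by (metis mult.left_commute)
  qed
  ultimately show "fourier (\<lambda>k. u (k + 1)) t = cis (- t) * fourier u t"
    unfolding fourier_def[of "\<lambda>k. u (k + 1)"] by (intro infsumI) (simp only:)
qed

lemma fourier_uminus: "fourier (\<lambda>k. - u k) t = - fourier u t"
  unfolding fourier_def by (simp add: infsum_uminus)

text \<open>With \<open>x = b * t^2\<close> these trade a Gaussian times 1,
  \<open>\<bar>t\<bar>\<close> or \<open>t^2\<close> for the Cauchy kernel that inversion
  expects.\<close>

lemma exp_neg_bounds:
  fixes x :: real
  assumes "0 \<le> x"
  shows "exp (- x) \<le> 1 / (1 + x)" "sqrt x * exp (- x) \<le> 1 / (1 + x)" "x * exp (- x) \<le> 2 / (1 + x)"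
proof -
  have e1: "1 + x \<le> exp x" by (rule exp_ge_add_one_self)
  have e2: "1 + x + x\<^sup>2 / 2 \<le> exp x" using exp_lower_Taylor_quadratic[OF assms] .
  have s: "2 * sqrt x \<le> 1 + x"
    using sum_squares_ge_zero[of "sqrt x - 1" 0] assms by (simp add: algebra_simps)
  have "sqrt x * (1 + x) \<le> (1 + x) / 2 * (1 + x)" using s assms by (intro mult_right_mono) auto
  also have "\<dots> \<le> exp x" using e2 by (simp add: power2_eq_square field_simps)
  finally have "sqrt x * (1 + x) \<le> exp x" .
  thus "sqrt x * exp (- x) \<le> 1 / (1 + x)" using assms by (simp add: exp_minus field_simps)
  show "exp (- x) \<le> 1 / (1 + x)" using e1 assms by (simp add: exp_minus field_simps)
  have "x * (1 + x) \<le> 2 * exp x" using e2 assms by (simp add: power2_eq_square field_simps)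
  thus "x * exp (- x) \<le> 2 / (1 + x)" using assms by (simp add: exp_minus field_simps)
qed

text \<open>Put \<open>b = c * n\<close>. Differencing multiplies the transform by a factor of size
  at most \<open>\<bar>t\<bar>\<close>, worth 1 / sqrt b, and inversion contributes another 1 / sqrt
  b. For the second moment the transform has size of order n, and inversion reduces this to order
  sqrt n.\<close>

lemma fourier_bounds_imp_kernel_bounds:
  assumes c: "0 < c" and K: "0 \<le> K" and n: "1 \<le> n" and \<phi>: "0 \<le> \<phi>" "\<phi> \<le> B * real n"
    and u: "fourier_bounds c K n \<phi> u"
  shows "\<bar>u k - u (k + 1)\<bar> \<le> 1 / c / real n"
    and "(real_of_int k)\<^sup>2 * u k \<le> (K * B + 2 * K\<^sup>2 * B\<^sup>2 / c) / sqrt c * sqrt (real n)"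
proof -
  have up: "is_prob_int u" and us2: "mom (mom u) summable_on UNIV" using u by (auto simp: fourier_bounds_def)
  have u0: "0 \<le> u k" for k using up by (simp add: is_prob_int_def)
  have us: "u summable_on UNIV" using up unfolding is_prob_int_def by (blast intro: has_sum_imp_summable)
  define b where "b = c * real n"
  have b: "0 < b" using c n by (simp add: b_def)
  have "0 \<le> B * real n" using \<phi> by (rule order_trans)
  hence B: "0 \<le> B" using n by (simp add: zero_le_mult_iff)
  have E: "exp (- c * t\<^sup>2) ^ n = exp (- (b * t\<^sup>2))" for t
    by (simp add: b_def flip: exp_of_nat_mult)
  have x0: "0 \<le> b * t\<^sup>2" for t using b by simp
  have "2 * \<bar>u k + - u (k + 1)\<bar> \<le> (1 / sqrt b) / sqrt b"
  proof (rule coefficient_bound[where w = "\<lambda>k. u k + - u (k + 1)" and k = k, OF _ _ b])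
    show "(\<lambda>k. u k + - u (k + 1)) summable_on UNIV"
      by (intro summable_on_add summable_on_uminus[THEN iffD2] us fourier_shift)
    fix t :: real assume t: "\<bar>t\<bar> \<le> pi"
    have "fourier (\<lambda>k. u k + - u (k + 1)) t = fourier u t + fourier (\<lambda>k. - u (k + 1)) t"
      by (intro fourier_add summable_on_uminus[THEN iffD2] us fourier_shift)
    also have "\<dots> = fourier u t * (1 - cis (- t))"
      by (simp add: fourier_uminus fourier_shift us algebra_simps)
    finally have "norm (fourier (\<lambda>k. u k + - u (k + 1)) t) = norm (fourier u t) * norm (cis (- t) - 1)"
      by (simp add: norm_mult norm_minus_commute)
    also have "\<dots> \<le> exp (- (b * t\<^sup>2)) * \<bar>- t\<bar>"
      using u t unfolding fourier_bounds_def E by (intro mult_mono norm_cis_minus_1_le) auto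
    also have "\<dots> = (1 / sqrt b) * (sqrt (b * t\<^sup>2) * exp (- (b * t\<^sup>2)))"
      using b by (simp add: real_sqrt_mult)
    also have "\<dots> \<le> (1 / sqrt b) * (1 / (1 + b * t\<^sup>2))"
      using b by (intro mult_left_mono exp_neg_bounds(2) x0) auto
    finally show "norm (fourier (\<lambda>k. u k + - u (k + 1)) t) \<le> (1 / sqrt b) / (1 + b * t\<^sup>2)" by simp
  qed (use b in simp)
  also have "(1 / sqrt b) / sqrt b = 1 / c / real n" using b by (simp add: b_def)
  finally have "2 * \<bar>u k - u (k + 1)\<bar> \<le> 1 / c / real n" by (simp only: diff_conv_add_uminus)
  moreover have "\<bar>u k - u (k + 1)\<bar> \<le> 2 * \<bar>u k - u (k + 1)\<bar>" by simp
  ultimately show "\<bar>u k - u (k + 1)\<bar> \<le> 1 / c / real n" by (meson order_trans)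
  define \<kappa> where "\<kappa> = (K * B + 2 * K\<^sup>2 * B\<^sup>2 / c) * real n"
  have "2 * \<bar>mom (mom u) k\<bar> \<le> \<kappa> / sqrt b"
  proof (rule coefficient_bound[OF us2 _ b])
    show "0 \<le> \<kappa>" using K B c by (simp add: \<kappa>_def)
    fix t :: real assume t: "\<bar>t\<bar> \<le> pi"
    have "norm (fourier (mom (mom u)) t) \<le> (K * \<phi> + K\<^sup>2 * \<phi>\<^sup>2 * t\<^sup>2) * exp (- (b * t\<^sup>2))"
      using u t unfolding fourier_bounds_def E by blast
    also have "\<dots> \<le> (K * (B * real n) + K\<^sup>2 * (B * real n)\<^sup>2 * t\<^sup>2) * exp (- (b * t\<^sup>2))"
      using K \<phi> by (intro mult_right_mono add_mono mult_left_mono power_mono) auto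
    also have "\<dots> = K * B * real n * exp (- (b * t\<^sup>2)) + K\<^sup>2 * B\<^sup>2 * real n / c * (b * t\<^sup>2 * exp (- (b * t\<^sup>2)))"
      using c by (simp add: b_def field_simps power2_eq_square)
    also have "\<dots> \<le> K * B * real n * (1 / (1 + b * t\<^sup>2)) + K\<^sup>2 * B\<^sup>2 * real n / c * (2 / (1 + b * t\<^sup>2))"
      using K B c by (intro add_mono mult_left_mono exp_neg_bounds x0) auto
    also have "\<dots> = \<kappa> / (1 + b * t\<^sup>2)" by (simp add: \<kappa>_def add_divide_distrib algebra_simps)
    finally show "norm (fourier (mom (mom u)) t) \<le> \<kappa> / (1 + b * t\<^sup>2)" .
  qed
  moreover have "mom (mom u) k = (real_of_int k)\<^sup>2 * u k" by (simp add: mom_def power2_eq_square)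
  moreover have "0 \<le> (real_of_int k)\<^sup>2 * u k" using u0 by simp
  ultimately have "(real_of_int k)\<^sup>2 * u k \<le> \<kappa> / sqrt b" by simp
  also have "\<dots> = (K * B + 2 * K\<^sup>2 * B\<^sup>2 / c) / sqrt c * sqrt (real n)"
    using c n by (simp add: \<kappa>_def b_def real_sqrt_mult field_simps)
  finally show "(real_of_int k)\<^sup>2 * u k \<le> (K * B + 2 * K\<^sup>2 * B\<^sup>2 / c) / sqrt c * sqrt (real n)" .
qed

lemma conv_prod_kernel_bounds:
  fixes \<nu> :: "nat \<Rightarrow> int \<Rightarrow> real"
  assumes "a > 0" "0 \<le> \<rho>" "\<rho> < 1"
    and \<nu>: "\<And>n. n \<ge> 1 \<Longrightarrow> is_prob_int (\<nu> n)"
      "\<And>n. n \<ge> 1 \<Longrightarrow> (\<lambda>k. \<bar>real_of_int k\<bar> * \<nu> n k) summable_on UNIV"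
      "\<And>n. n \<ge> 1 \<Longrightarrow> mean_int (\<nu> n) = 0"
      "\<And>n. n \<ge> 1 \<Longrightarrow> m1_int (\<nu> n) \<le> a"
      "\<And>n \<beta> r. n \<ge> 1 \<Longrightarrow> \<beta> \<notin> {1, -1} \<Longrightarrow> coset_mass (\<nu> n) \<beta> r \<le> \<rho>"
      "\<And>n. n \<ge> 1 \<Longrightarrow> (\<lambda>k. (real_of_int k)\<^sup>2 * \<nu> n k) summable_on UNIV"
    and C: "\<And>n. n \<ge> 1 \<Longrightarrow> (\<Sum>i=1..n. m2_int (\<nu> i)) \<le> B * real n"
  shows "\<And>n. is_prob_int (conv_prod \<nu> n)"
    and "\<exists>C>0. \<forall>n\<ge>1. \<forall>k. \<bar>conv_prod \<nu> n k - conv_prod \<nu> n (k + 1)\<bar> \<le> C / real n \<and>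
           (real_of_int k)\<^sup>2 * conv_prod \<nu> n k \<le> C * sqrt (real n)"
proof -
  \<comment> \<open>The rate depends only on \<open>a\<close> and \<open>\<rho>\<close>, so the same
    \<open>c\<close> serves every factor of the product.\<close>
  obtain c where c: "0 < c" and g: "\<And>n t. n \<ge> 1 \<Longrightarrow> \<bar>t\<bar> \<le> pi \<Longrightarrow> norm (fourier (\<nu> n) t) \<le> exp (- c * t\<^sup>2)"
  proof -
    from fourier_gaussian_bound[OF assms(1-3)] obtain c where "0 < c" and
      "\<And>\<nu> t. is_prob_int \<nu> \<Longrightarrow> (\<lambda>k. \<bar>real_of_int k\<bar> * \<nu> k) summable_on UNIV \<Longrightarrow>
      m1_int \<nu> \<le> a \<Longrightarrow> (\<And>\<beta> r. \<beta> \<notin> {1, -1} \<Longrightarrow> coset_mass \<nu> \<beta> r \<le> \<rho>) \<Longrightarrow> \<bar>t\<bar> \<le> pi \<Longrightarrow>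
      norm (fourier \<nu> t) \<le> exp (- c * t\<^sup>2)" by blast
    thus ?thesis using \<nu> by (intro that[of c]) auto
  qed
  define K where "K = exp (c * pi\<^sup>2)"
  have K0: "0 \<le> K" by (simp add: K_def)
  have ms: "mom (\<nu> n) summable_on UNIV" if n: "n \<ge> 1" for n
  proof -
    have "norm (mom (\<nu> n) k) = \<bar>real_of_int k\<bar> * \<nu> n k" for k
      using \<nu>(1)[OF n] by (simp add: mom_def abs_mult is_prob_int_def)
    hence "(\<lambda>k. norm (mom (\<nu> n) k)) summable_on UNIV" using \<nu>(2)[OF n] by simp
    thus ?thesis by (rule abs_summable_summable)
  qed
  have m20: "0 \<le> m2_int (\<nu> n)" if n: "n \<ge> 1" for n
    using fourier_moment_bounds(2)[OF \<nu>(1)[OF n] ms[OF n] \<nu>(3)[OF n] \<nu>(6)[OF n]] .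
  have inv: "fourier_bounds c K n (\<Sum>i=1..n. m2_int (\<nu> i)) (conv_prod \<nu> n)" for n
  proof (induction n)
    case 0
    show ?case using fourier_bounds_0[OF K0, of c] by simp
  next
    case (Suc n)
    have "fourier_bounds c K (Suc n) ((\<Sum>i=1..n. m2_int (\<nu> i)) + m2_int (\<nu> (Suc n))) (conv_int (conv_prod \<nu> n) (\<nu> (Suc n)))"
      by (rule fourier_bounds_Suc[OF c _ _ Suc]) (auto simp: K_def intro!: sum_nonneg m20 \<nu>(1,3,6) ms g[unfolded minus_mult_left[symmetric]])
    thus ?case by (simp add: conv_prod_Suc)
  qed
  show "is_prob_int (conv_prod \<nu> n)" for n using inv[of n] by (simp add: fourier_bounds_def)
  define C1 where "C1 = max (1 / c) ((K * B + 2 * K\<^sup>2 * B\<^sup>2 / c) / sqrt c)"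
  show "\<exists>C>0. \<forall>n\<ge>1. \<forall>k. \<bar>conv_prod \<nu> n k - conv_prod \<nu> n (k + 1)\<bar> \<le> C / real n \<and>
           (real_of_int k)\<^sup>2 * conv_prod \<nu> n k \<le> C * sqrt (real n)"
  proof (intro exI[of _ C1] conjI allI impI)
    show "0 < C1" using c by (simp add: C1_def less_max_iff_disj)
    fix n k assume n: "1 \<le> (n::nat)"
    have \<phi>0: "0 \<le> (\<Sum>i=1..n. m2_int (\<nu> i))" by (intro sum_nonneg m20) auto
    note kb = fourier_bounds_imp_kernel_bounds[OF c K0 n \<phi>0 C[OF n] inv, of k]
    show "\<bar>conv_prod \<nu> n k - conv_prod \<nu> n (k + 1)\<bar> \<le> C1 / real n"
      using kb(1) by (rule order_trans) (intro divide_right_mono, simp_all add: C1_def)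
    show "(real_of_int k)\<^sup>2 * conv_prod \<nu> n k \<le> C1 * sqrt (real n)"
      using kb(2) by (rule order_trans) (intro mult_right_mono, simp_all add: C1_def)
  qed
qed

section \<open>Weighted sums along orbits\<close>

text \<open>Abel summation: linear growth of the partial sums against the inverse square weights
  leaves a telescoping tail of order 1 / L.\<close>

lemma weighted_tail_bound:
  fixes b :: "nat \<Rightarrow> real"
  assumes B: "\<And>N. (\<Sum>k<N. \<bar>b k\<bar>) \<le> B * real N" and L: "1 \<le> L" "L \<le> N"
  shows "(\<Sum>k=L..<N. \<bar>b k\<bar> / (real k)\<^sup>2) \<le> 3 * B / real L"
proof -
  define T where "T N = (\<Sum>k<N. \<bar>b k\<bar>)" for N
  have B0: "0 \<le> B" using B[of 1] by (simp add: order_trans[OF abs_ge_zero])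
  \<comment> \<open>The boundary term of Abel summation is kept in the induction hypothesis and
    discarded only at the end.\<close>
  have "(\<Sum>k=L..<N. \<bar>b k\<bar> / (real k)\<^sup>2) \<le> T N / (real N)\<^sup>2 + 3 * B * (1 / real L - 1 / real N)"
    using \<open>L \<le> N\<close>
  proof (induction N rule: dec_induct)
    case base
    show ?case by (simp add: T_def sum_nonneg)
  next
    case (step n)
    define x where "x = real n"
    have x: "1 \<le> x" using step L by (simp add: x_def)
    have TS: "T (Suc n) = T n + \<bar>b n\<bar>" by (simp add: T_def)
    have "T (Suc n) * (1 / x\<^sup>2 - 1 / (x+1)\<^sup>2) \<le> (B * (x+1)) * (1 / x\<^sup>2 - 1 / (x+1)\<^sup>2)"
    proof (rule mult_right_mono)
      show "T (Suc n) \<le> B * (x+1)" using B[of "Suc n"] by (simp add: T_def x_def add.commute)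
      show "0 \<le> 1 / x\<^sup>2 - 1 / (x+1)\<^sup>2" using x by (simp add: frac_le power_mono)
    qed
    also have "\<dots> = B * ((2*x+1) / (x\<^sup>2 * (x+1)))"
    proof -
      have "(x+1) * (1 / x\<^sup>2 - 1 / (x+1)\<^sup>2) = (2*x+1) / (x\<^sup>2 * (x+1))"
        using x by (simp add: divide_simps) (simp add: power2_eq_square algebra_simps)
      thus ?thesis by (simp add: mult.assoc)
    qed
    \<comment> \<open>Here \<open>2*x+1 \<le> 3*x\<close> since \<open>x\<close> is at least 1; this
      is the source of the factor 3.\<close>
    also have "\<dots> \<le> B * ((3*x) / (x\<^sup>2 * (x+1)))"
      using x B0 by (intro mult_left_mono divide_right_mono) auto
    also have "\<dots> = 3 * B * (1 / x - 1 / (x+1))"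
      using x by (simp add: divide_simps power2_eq_square)
    finally have "T (Suc n) / x\<^sup>2 - T (Suc n) / (x+1)\<^sup>2 \<le> 3 * B * (1 / x - 1 / (x+1))"
      by (simp add: algebra_simps)
    thus ?case using step TS
      by (simp add: x_def algebra_simps add_divide_distrib)
  qed
  also have "T N / (real N)\<^sup>2 \<le> B / real N"
  proof -
    have "T N / (real N)\<^sup>2 \<le> B * real N / (real N)\<^sup>2"
      using B[of N] by (intro divide_right_mono) (auto simp: T_def)
    thus ?thesis using L by (simp add: power2_eq_square)
  qed
  also have "B / real N + 3 * B * (1 / real L - 1 / real N) \<le> 3 * B / real L"
    using B0 L by (simp add: algebra_simps)
  finally show ?thesis by simp
qed

lemma summation_by_parts:
  fixes u b :: "nat \<Rightarrow> real"
  shows "(\<Sum>k<L. u k * b k) = u L * (\<Sum>k<L. b k) + (\<Sum>k<L. (\<Sum>i<Suc k. b i) * (u k - u (Suc k)))"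
  by (induction L) (simp_all add: algebra_simps)

lemma weighted_sum_tendsto_0:
  fixes u :: "nat \<Rightarrow> nat \<Rightarrow> real" and b :: "nat \<Rightarrow> real"
  assumes C: "0 < C"
    and u0: "\<And>n k. 0 \<le> u n k"
    and ud: "\<And>n k. 1 \<le> n \<Longrightarrow> \<bar>u n k - u n (Suc k)\<bar> \<le> C / real n"
    and ut: "\<And>n k. 1 \<le> n \<Longrightarrow> (real k)\<^sup>2 * u n k \<le> C * sqrt (real n)"
    and b: "\<And>\<epsilon>. 0 < \<epsilon> \<Longrightarrow> \<exists>K. \<forall>N. \<bar>\<Sum>k<N. b k\<bar> \<le> \<epsilon> * real N + K"
    and B: "\<And>N. (\<Sum>k<N. \<bar>b k\<bar>) \<le> B * real N"
  shows "\<And>n. 1 \<le> n \<Longrightarrow> summable (\<lambda>k. \<bar>u n k * b k\<bar>)"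
    and "(\<lambda>n. \<Sum>k. u n k * b k) \<longlonglongrightarrow> 0"
proof -
  have B0: "0 \<le> B" using B[of 1] by (simp add: order_trans[OF abs_ge_zero])
  have tail: "(\<Sum>k=L..<N. \<bar>u n k * b k\<bar>) \<le> C * sqrt n * (3 * B / real L)"
    if "1 \<le> n" "1 \<le> L" "L \<le> N" for n L N :: nat
  proof -
    have "(\<Sum>k=L..<N. \<bar>u n k * b k\<bar>) \<le> (\<Sum>k=L..<N. C * sqrt n * (\<bar>b k\<bar> / (real k)\<^sup>2))"
    proof (rule sum_mono)
      fix k assume "k \<in> {L..<N}"
      hence "0 < real k" using that by auto
      hence "u n k \<le> C * sqrt n / (real k)\<^sup>2"
        using ut[OF that(1), of k] by (simp add: field_simps)
      hence "u n k * \<bar>b k\<bar> \<le> C * sqrt n / (real k)\<^sup>2 * \<bar>b k\<bar>" by (rule mult_right_mono) auto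
      thus "\<bar>u n k * b k\<bar> \<le> C * sqrt n * (\<bar>b k\<bar> / (real k)\<^sup>2)" using u0[of n k] by (simp add: abs_mult)
    qed
    also have "\<dots> = C * sqrt n * (\<Sum>k=L..<N. \<bar>b k\<bar> / (real k)\<^sup>2)" by (simp add: sum_distrib_left)
    also have "\<dots> \<le> C * sqrt n * (3 * B / real L)"
      using weighted_tail_bound[OF B that(2,3)] C by (intro mult_left_mono) auto
    finally show ?thesis .
  qed
  show sm: "summable (\<lambda>k. \<bar>u n k * b k\<bar>)" if n: "1 \<le> n" for n
  proof (rule summableI_nonneg_bounded)
    fix N
    \<comment> \<open>The term at \<open>k = 0\<close> is split off because the decay bound is empty
      there.\<close>
    have "(\<Sum>k<N. \<bar>u n k * b k\<bar>) \<le> (\<Sum>k<Suc N. \<bar>u n k * b k\<bar>)" by simp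
    also have "\<dots> = (\<Sum>k\<in>{0..<Suc 0}. \<bar>u n k * b k\<bar>) + (\<Sum>k=Suc 0..<Suc N. \<bar>u n k * b k\<bar>)"
      unfolding lessThan_atLeast0 by (rule sum.atLeastLessThan_concat[symmetric]) auto
    also have "\<dots> \<le> \<bar>u n 0 * b 0\<bar> + C * sqrt n * (3 * B / real 1)"
      using tail[OF n, of 1 "Suc N"] by simp
    finally show "(\<Sum>k<N. \<bar>u n k * b k\<bar>) \<le> \<bar>u n 0 * b 0\<bar> + C * sqrt n * (3 * B / real 1)" .
  qed simp
  show "(\<lambda>n. \<Sum>k. u n k * b k) \<longlonglongrightarrow> 0"
  proof (rule LIMSEQ_I)
    fix \<eta> :: real assume \<eta>: "0 < \<eta>"
    \<comment> \<open>\<open>A\<close> depends only on the tail estimate, before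
      \<open>\<epsilon>\<close> and \<open>n\<close> are chosen.\<close>
    obtain A :: nat where A: "real A > 9 * B * C / \<eta> + 1" using reals_Archimedean2 by blast
    have A1: "1 < real A" using A B0 C \<eta> by (smt (verit) divide_nonneg_pos mult_nonneg_nonneg)
    have A2: "3 * B * C / real A < \<eta> / 3" using A A1 \<eta> by (simp add: field_simps)
    \<comment> \<open>The head costs \<open>5 * A^2 * C * \<epsilon>\<close>, made equal to
      \<open>\<eta> / 3\<close>: 1 comes from the boundary term, 4 from squaring
      \<open>L \<le> 2 * (A * s)\<close>.\<close>
    define \<epsilon> where "\<epsilon> = \<eta> / (15 * (real A)\<^sup>2 * C)"
    have \<epsilon>: "0 < \<epsilon>" using \<eta> A1 C by (simp add: \<epsilon>_def)
    obtain K where K: "\<And>N. \<bar>\<Sum>k<N. b k\<bar> \<le> \<epsilon> * real N + K" using b[OF \<epsilon>] by blast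
    have K0: "0 \<le> K" using K[of 0] by simp
    \<comment> \<open>The additive constant \<open>K\<close> contributes
      \<open>3 * A * K * C / s\<close>, which large \<open>n\<close> makes smaller than
      \<open>\<eta> / 3\<close>; the extra 1 secures \<open>1 < n\<close>.\<close>
    obtain n0 :: nat where n0: "real n0 > (9 * real A * K * C / \<eta>)\<^sup>2 + 1" using reals_Archimedean2 by blast
    txt \<open>Split at \<open>L \<approx> A \<surd>n\<close>: the head is small by summation by parts, the tail is \<open>O(1 / A)\<close>.\<close>
    show "\<exists>no. \<forall>n\<ge>no. norm ((\<Sum>k. u n k * b k) - 0) < \<eta>"
    proof (intro exI allI impI)
      fix n assume "n \<ge> n0"
      hence nn: "real n > (9 * real A * K * C / \<eta>)\<^sup>2 + 1" using n0 by linarith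
      hence n1: "1 < real n" by (smt (verit) zero_le_power2)
      define s where "s = sqrt (real n)"
      have s1: "1 < s" using n1 by (simp add: s_def)
      have s2: "s\<^sup>2 = real n" using n1 by (simp add: s_def)
      have "(9 * real A * K * C / \<eta>)\<^sup>2 < s\<^sup>2" using nn s2 by linarith
      hence "9 * real A * K * C / \<eta> < s" using s1 by (meson less_eq_real_def power2_less_imp_less zero_less_one order.trans)
      hence sK: "3 * real A * K * C / s < \<eta> / 3" using \<eta> s1 by (simp add: field_simps)
      define L where "L = nat \<lceil>real A * s\<rceil>"
      have As: "1 \<le> real A * s" using A1 s1 by (smt (verit) mult_le_cancel_left1)
      have L1: "real A * s \<le> real L" unfolding L_def by linarith
      have L2: "real L \<le> 2 * (real A * s)" unfolding L_def using As by linarith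
      have Lp: "1 \<le> L" using L1 As by linarith
      have n1': "1 \<le> n" using n1 by simp
      have uL: "u n L \<le> C * s / (real L)\<^sup>2"
        using ut[OF n1', of L] Lp by (simp add: s_def field_simps)
      have head: "\<bar>\<Sum>k<L. u n k * b k\<bar> \<le> 5 * (real A)\<^sup>2 * C * \<epsilon> + 3 * real A * K * C / s"
      proof -
        have S: "0 \<le> \<epsilon> * real L + K" using \<epsilon> K0 by simp
        have "\<bar>u n L * (\<Sum>k<L. b k)\<bar> = u n L * \<bar>\<Sum>k<L. b k\<bar>" using u0[of n L] by (simp add: abs_mult)
        also have "\<dots> \<le> C * s / (real L)\<^sup>2 * (\<epsilon> * real L + K)"
          using uL K[of L] C s1 by (intro mult_mono) auto
        also have "\<dots> = C * s * (\<epsilon> / real L + K / (real L)\<^sup>2)"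
          using Lp by (simp add: field_simps power2_eq_square)
        also have "\<dots> \<le> C * s * (\<epsilon> / s + K / s\<^sup>2)"
        proof -
          have "s \<le> real L" using L1 A1 s1 by (smt (verit) mult_le_cancel_right1)
          thus ?thesis using C s1 \<epsilon> K0
            by (intro mult_left_mono add_mono divide_left_mono power_mono mult_pos_pos) auto
        qed
        also have "\<dots> = C * \<epsilon> + K * C / s" using s1 by (simp add: field_simps power2_eq_square)
        finally have 1: "\<bar>u n L * (\<Sum>k<L. b k)\<bar> \<le> C * \<epsilon> + K * C / s" .
        have "\<bar>\<Sum>k<L. (\<Sum>i<Suc k. b i) * (u n k - u n (Suc k))\<bar>
            \<le> (\<Sum>k<L. \<bar>(\<Sum>i<Suc k. b i) * (u n k - u n (Suc k))\<bar>)" by (rule sum_abs)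
        also have "\<dots> \<le> (\<Sum>k<L. (\<epsilon> * real L + K) * (C / real n))"
        proof (rule sum_mono)
          fix k assume k: "k \<in> {..<L}"
          have "\<bar>\<Sum>i<Suc k. b i\<bar> \<le> \<epsilon> * real (Suc k) + K" by (rule K)
          also have "\<dots> \<le> \<epsilon> * real L + K" using k \<epsilon> by (intro add_mono mult_left_mono) auto
          finally show "\<bar>(\<Sum>i<Suc k. b i) * (u n k - u n (Suc k))\<bar> \<le> (\<epsilon> * real L + K) * (C / real n)"
            unfolding abs_mult using ud[OF n1', of k] S by (intro mult_mono) auto
        qed
        also have "\<dots> = (C / s\<^sup>2) * (\<epsilon> * (real L)\<^sup>2 + K * real L)" unfolding s2 by (simp add: power2_eq_square algebra_simps)
        also have "\<dots> \<le> (C / s\<^sup>2) * (\<epsilon> * (2 * (real A * s))\<^sup>2 + K * (2 * (real A * s)))"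
          using L2 C \<epsilon> K0 s1 by (intro mult_left_mono add_mono power_mono) auto
        also have "\<dots> = 4 * (real A)\<^sup>2 * C * \<epsilon> + 2 * real A * K * C / s"
          using s1 by (simp add: field_simps power2_eq_square)
        finally have 2: "\<bar>\<Sum>k<L. (\<Sum>i<Suc k. b i) * (u n k - u n (Suc k))\<bar>
            \<le> 4 * (real A)\<^sup>2 * C * \<epsilon> + 2 * real A * K * C / s" .
        have "C * \<epsilon> \<le> (real A)\<^sup>2 * (C * \<epsilon>)" using A1 C \<epsilon> mult_right_mono[of 1 "(real A)\<^sup>2" "C * \<epsilon>"] by (simp add: one_le_power)
        moreover have "K * C / s \<le> real A * (K * C / s)"
          using A1 K0 C s1 mult_right_mono[of 1 "real A" "K * C / s"] by simp
        moreover have "\<bar>\<Sum>k<L. u n k * b k\<bar> \<le> \<bar>u n L * (\<Sum>k<L. b k)\<bar>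
             + \<bar>\<Sum>k<L. (\<Sum>i<Suc k. b i) * (u n k - u n (Suc k))\<bar>"
          by (subst summation_by_parts) (rule abs_triangle_ineq)
        ultimately show ?thesis using 1 2 by (simp add: algebra_simps)
      qed
      have h1: "5 * (real A)\<^sup>2 * C * \<epsilon> = \<eta> / 3" using A1 C by (simp add: \<epsilon>_def field_simps)
      have bound: "\<bar>\<Sum>k<N. u n k * b k\<bar> \<le> \<eta> / 3 + 3 * real A * K * C / s + 3 * B * C / real A" if "N \<ge> L" for N
      proof -
        have "\<bar>\<Sum>k=L..<N. u n k * b k\<bar> \<le> (\<Sum>k=L..<N. \<bar>u n k * b k\<bar>)" by (rule sum_abs)
        also have "\<dots> \<le> C * s * (3 * B / real L)" unfolding s_def by (rule tail[OF n1' Lp that])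
        also have "\<dots> \<le> C * s * (3 * B / (real A * s))"
          using L1 Lp B0 C s1 A1 by (intro mult_left_mono divide_left_mono mult_pos_pos) auto
        also have "\<dots> = 3 * B * C / real A" using s1 by simp
        finally have "\<bar>\<Sum>k=L..<N. u n k * b k\<bar> \<le> 3 * B * C / real A" .
        moreover have "(\<Sum>k<N. u n k * b k) = (\<Sum>k<L. u n k * b k) + (\<Sum>k=L..<N. u n k * b k)"
          unfolding lessThan_atLeast0 by (rule sum.atLeastLessThan_concat[symmetric]) (use that in auto)
        ultimately show ?thesis using head h1 by linarith
      qed
      have "summable (\<lambda>k. u n k * b k)" using sm[OF n1'] by (rule summable_rabs_cancel)
      hence "(\<lambda>N. \<bar>\<Sum>k<N. u n k * b k\<bar>) \<longlonglongrightarrow> \<bar>\<Sum>k. u n k * b k\<bar>"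
        by (intro tendsto_rabs summable_LIMSEQ)
      hence "\<bar>\<Sum>k. u n k * b k\<bar> \<le> \<eta> / 3 + 3 * real A * K * C / s + 3 * B * C / real A"
        by (rule LIMSEQ_le_const2) (use bound in blast)
      also have "\<dots> < \<eta>" using sK A2 by linarith
      finally show "norm ((\<Sum>k. u n k * b k) - 0) < \<eta>" by simp
    qed
  qed
qed

text \<open>Centring at \<open>F\<close> makes the averages tend to 0. The affine bound becomes
  linear because \<open>K0 \<le> \<bar>K0\<bar> * N\<close> as soon as \<open>N\<close> is at least
  1.\<close>

lemma orbit_half_sum_tendsto:
  fixes u :: "nat \<Rightarrow> nat \<Rightarrow> real" and v :: "nat \<Rightarrow> real" and F :: real
  assumes C: "0 < C"
    and u: "\<And>n k. 0 \<le> u n k" "\<And>n k. 1 \<le> n \<Longrightarrow> \<bar>u n k - u n (Suc k)\<bar> \<le> C / real n"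
      "\<And>n k. 1 \<le> n \<Longrightarrow> (real k)\<^sup>2 * u n k \<le> C * sqrt (real n)"
    and avg: "\<And>\<epsilon>. 0 < \<epsilon> \<Longrightarrow> \<exists>K. \<forall>N. \<bar>(\<Sum>k<N. v k) - F * real N\<bar> \<le> \<epsilon> * real N + K"
    and bnd: "\<And>N. (\<Sum>k<N. \<bar>v k\<bar>) \<le> \<beta> * real N + K0"
  shows "\<And>n. 1 \<le> n \<Longrightarrow> summable (\<lambda>k. \<bar>u n k * (v k - F)\<bar>)"
    and "(\<lambda>n. \<Sum>k. u n k * (v k - F)) \<longlonglongrightarrow> 0"
proof -
  have B: "(\<Sum>k<N. \<bar>v k - F\<bar>) \<le> (\<bar>\<beta>\<bar> + \<bar>K0\<bar> + \<bar>F\<bar>) * real N" for N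
  proof (cases "N = 0")
    case False
    have "(\<Sum>k<N. \<bar>v k - F\<bar>) \<le> (\<Sum>k<N. \<bar>v k\<bar> + \<bar>F\<bar>)" by (intro sum_mono abs_triangle_ineq4)
    also have "\<dots> \<le> \<beta> * real N + K0 + \<bar>F\<bar> * real N" using bnd[of N] by (simp add: sum.distrib mult.commute)
    also have "\<beta> * real N \<le> \<bar>\<beta>\<bar> * real N" by (intro mult_right_mono) auto
    also have "K0 \<le> \<bar>K0\<bar> * real N" using False mult_left_mono[of 1 "real N" "\<bar>K0\<bar>"] by simp
    finally show ?thesis by (simp add: algebra_simps)
  qed simp
  have A: "\<exists>K. \<forall>N. \<bar>\<Sum>k<N. v k - F\<bar> \<le> \<epsilon> * real N + K" if "0 < \<epsilon>" for \<epsilon>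
    using avg[OF that] by (simp add: sum_subtractf mult.commute)
  note W = weighted_sum_tendsto_0[where u = u and b = "\<lambda>k. v k - F", OF C u A B]
  show "\<And>n. 1 \<le> n \<Longrightarrow> summable (\<lambda>k. \<bar>u n k * (v k - F)\<bar>)" by (rule W(1))
  show "(\<lambda>n. \<Sum>k. u n k * (v k - F)) \<longlonglongrightarrow> 0" by (rule W(2))
qed

section \<open>Joining the two half-lines\<close>

lemma has_sum_int_split:
  fixes h :: "int \<Rightarrow> real"
  assumes "summable (\<lambda>k. \<bar>h (int k)\<bar>)" "summable (\<lambda>k. \<bar>h (- int k - 1)\<bar>)"
  shows "(h has_sum ((\<Sum>k. h (int k)) + (\<Sum>k. h (- int k - 1)))) UNIV"
proof -
  have half: "((\<lambda>k. h (g k)) has_sum (\<Sum>k. h (g k))) UNIV" if "summable (\<lambda>k. \<bar>h (g k)\<bar>)" for g :: "nat \<Rightarrow> int"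
    using that by (intro norm_summable_imp_has_sum summable_sums) (auto intro: summable_rabs_cancel)
  have inj: "inj (\<lambda>k. - int k - 1)" by (auto intro: injI)
  have "(h has_sum (\<Sum>k. h (int k))) (range int)"
    using half[OF assms(1)] by (subst has_sum_reindex) (auto simp: o_def)
  moreover have "(h has_sum (\<Sum>k. h (- int k - 1))) (range (\<lambda>k. - int k - 1))"
    using half[OF assms(2)] by (subst has_sum_reindex[OF inj]) (auto simp: o_def)
  moreover have "range int \<inter> range (\<lambda>k. - int k - 1) = {}" by auto
  ultimately have "(h has_sum ((\<Sum>k. h (int k)) + (\<Sum>k. h (- int k - 1)))) (range int \<union> range (\<lambda>k. - int k - 1))"
    by (rule has_sum_Un_disjoint)
  moreover have "range int \<union> range (\<lambda>k. - int k - 1) = UNIV"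
  proof -
    have "z \<in> range int \<union> range (\<lambda>k. - int k - 1)" for z
    proof (cases "0 \<le> z")
      case True
      thus ?thesis by (auto intro: image_eqI[of _ _ "nat z"])
    next
      case False
      thus ?thesis by (auto intro: image_eqI[of _ _ "nat (- z - 1)"])
    qed
    thus ?thesis by blast
  qed
  ultimately show ?thesis by simp
qed

lemma sum_lessThan_shift: "(\<Sum>k<N. g (Suc k)) = (\<Sum>k<Suc N. g k) - (g 0 :: real)"
  by (subst sum.lessThan_Suc_shift) simp

text \<open>Both half-lines are centred at the same \<open>F\<close>, so each half tends to 0 and
  total mass 1 restores \<open>F\<close>, however that mass is distributed between them.\<close>

lemma int_weighted_sum_tendsto:
  fixes u :: "nat \<Rightarrow> int \<Rightarrow> real" and g :: "int \<Rightarrow> real" and F :: real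
  assumes C: "0 < C"
    and prob: "\<And>n. is_prob_int (u n)"
    and u: "\<And>n k. 1 \<le> n \<Longrightarrow> \<bar>u n k - u n (k + 1)\<bar> \<le> C / real n"
      "\<And>n k. 1 \<le> n \<Longrightarrow> (real_of_int k)\<^sup>2 * u n k \<le> C * sqrt (real n)"
    and fw: "\<And>\<epsilon>. 0 < \<epsilon> \<Longrightarrow> \<exists>K. \<forall>N. \<bar>(\<Sum>k<N. g (int k)) - F * real N\<bar> \<le> \<epsilon> * real N + K"
    and bw: "\<And>\<epsilon>. 0 < \<epsilon> \<Longrightarrow> \<exists>K. \<forall>N. \<bar>(\<Sum>k<N. g (- int k)) - F * real N\<bar> \<le> \<epsilon> * real N + K"
    and fwb: "\<exists>\<beta> K. \<forall>N. (\<Sum>k<N. \<bar>g (int k)\<bar>) \<le> \<beta> * real N + K"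
    and bwb: "\<exists>\<beta> K. \<forall>N. (\<Sum>k<N. \<bar>g (- int k)\<bar>) \<le> \<beta> * real N + K"
  shows "(\<lambda>n. \<Sum>\<^sub>\<infinity>k. u n k * g k) \<longlonglongrightarrow> F"
proof -
  have u0: "0 \<le> u n k" for n k using prob[of n] by (simp add: is_prob_int_def)
  define p where "p n = (\<Sum>k. u n (int k) * (g (int k) - F))" for n
  define q where "q n = (\<Sum>k. u n (- int k - 1) * (g (- int k - 1) - F))" for n
  obtain \<beta>1 K1 where b1: "\<And>N. (\<Sum>k<N. \<bar>g (int k)\<bar>) \<le> \<beta>1 * real N + K1" using fwb by blast
  obtain \<beta>2 K2 where b2: "\<And>N. (\<Sum>k<N. \<bar>g (- int k)\<bar>) \<le> \<beta>2 * real N + K2" using bwb by blast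
  have ud1: "\<bar>u n (int k) - u n (int (Suc k))\<bar> \<le> C / real n" if "1 \<le> n" for n k
    using u(1)[OF that, of "int k"] by (simp add: add.commute)
  have ut1: "(real k)\<^sup>2 * u n (int k) \<le> C * sqrt (real n)" if "1 \<le> n" for n k
    using u(2)[OF that, of "int k"] by simp
  have P: "summable (\<lambda>k. \<bar>u n (int k) * (g (int k) - F)\<bar>)" if "1 \<le> n" for n
    by (rule orbit_half_sum_tendsto(1)[OF C u0 ud1 ut1 fw b1]) (assumption | rule that)+
  have p: "p \<longlonglongrightarrow> 0"
    unfolding p_def by (rule orbit_half_sum_tendsto(2)[OF C u0 ud1 ut1 fw b1])
  have ud2: "\<bar>u n (- int k - 1) - u n (- int (Suc k) - 1)\<bar> \<le> C / real n" if "1 \<le> n" for n k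
  proof -
    have "u n (- int (Suc k) - 1 + 1) = u n (- int k - 1)" by (rule arg_cong[where f = "u n"]) simp
    thus ?thesis using u(1)[OF that, of "- int (Suc k) - 1"] by (simp only: abs_minus_commute)
  qed
  have ut2: "(real k)\<^sup>2 * u n (- int k - 1) \<le> C * sqrt (real n)" if "1 \<le> n" for n k
  proof -
    have "(real k)\<^sup>2 \<le> (real_of_int (- int k - 1))\<^sup>2" by (simp add: power2_eq_square algebra_simps)
    hence "(real k)\<^sup>2 * u n (- int k - 1) \<le> (real_of_int (- int k - 1))\<^sup>2 * u n (- int k - 1)"
      by (rule mult_right_mono[OF _ u0])
    thus ?thesis using u(2)[OF that, of "- int k - 1"] by linarith
  qed
  have shift: "- int k - 1 = - int (Suc k)" for k by simp
  \<comment> \<open>The backward half starts at -1, since 0 belongs to the forward half; removing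
    one term only alters the additive constant.\<close>
  have bw': "\<exists>K. \<forall>N. \<bar>(\<Sum>k<N. g (- int k - 1)) - F * real N\<bar> \<le> \<epsilon> * real N + K" if pos: "0 < \<epsilon>" for \<epsilon>
  proof -
    obtain K where K: "\<And>N. \<bar>(\<Sum>k<N. g (- int k)) - F * real N\<bar> \<le> \<epsilon> * real N + K" using bw[OF pos] by blast
    have "\<bar>(\<Sum>k<N. g (- int k - 1)) - F * real N\<bar> \<le> \<epsilon> * real N + (\<epsilon> + K + \<bar>F - g 0\<bar>)" for N
      using K[of "Suc N"] unfolding shift sum_lessThan_shift[of "\<lambda>k. g (- int k)"]
      by (simp add: algebra_simps del: sum.lessThan_Suc)
    thus ?thesis by blast
  qed
  have b2': "(\<Sum>k<N. \<bar>g (- int k - 1)\<bar>) \<le> \<beta>2 * real N + (\<beta>2 + K2)" for N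
    using b2[of "Suc N"] unfolding shift sum_lessThan_shift[of "\<lambda>k. \<bar>g (- int k)\<bar>"]
    by (simp add: algebra_simps del: sum.lessThan_Suc)
  have Q: "summable (\<lambda>k. \<bar>u n (- int k - 1) * (g (- int k - 1) - F)\<bar>)" if "1 \<le> n" for n
    by (rule orbit_half_sum_tendsto(1)[OF C u0 ud2 ut2 bw' b2']) (assumption | rule that)+
  have q: "q \<longlonglongrightarrow> 0"
    unfolding q_def by (rule orbit_half_sum_tendsto(2)[OF C u0 ud2 ut2 bw' b2'])
  have "(\<Sum>\<^sub>\<infinity>k. u n k * g k) = p n + q n + F" if n: "1 \<le> n" for n
  proof -
    have "((\<lambda>k. u n k * (g k - F)) has_sum (p n + q n)) UNIV"
      unfolding p_def q_def by (rule has_sum_int_split[OF P[OF n] Q[OF n]])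
    moreover have "((\<lambda>k. u n k * F) has_sum (1 * F)) UNIV"
      using prob[of n] by (intro has_sum_cmult_left) (simp add: is_prob_int_def)
    ultimately have "((\<lambda>k. u n k * (g k - F) + u n k * F) has_sum (p n + q n + 1 * F)) UNIV"
      by (rule has_sum_add)
    thus ?thesis by (intro infsumI) (simp add: algebra_simps)
  qed
  hence "\<forall>\<^sub>F n in sequentially. p n + q n + F = (\<Sum>\<^sub>\<infinity>k. u n k * g k)"
    by (intro eventually_sequentiallyI[of 1]) simp
  moreover have "(\<lambda>n. p n + q n + F) \<longlonglongrightarrow> 0 + 0 + F"
    by (intro tendsto_intros p q)
  ultimately show ?thesis using Lim_transform_eventually by fastforce
qed

theorem theorem3p4:
  fixes M :: "'a measure" and \<tau> :: "'a \<Rightarrow> 'a"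
    and \<nu> :: "nat \<Rightarrow> int \<Rightarrow> real" and a \<rho> :: real and f :: "'a \<Rightarrow> real"
  assumes "prob_space M" and "non_atomic M" and "separable_measure M"
    and "bij_betw \<tau> (space M) (space M)"
    and "\<tau> \<in> measurable M M" and "distr M M \<tau> = M"
    and "the_inv_into (space M) \<tau> \<in> measurable M M"
    and "distr M M (the_inv_into (space M) \<tau>) = M"
    and "a > 0" and "0 \<le> \<rho>" and "\<rho> < 1"
    and "\<And>n. n \<ge> 1 \<Longrightarrow> is_prob_int (\<nu> n)"
    and "\<And>n. n \<ge> 1 \<Longrightarrow> (\<lambda>k. \<bar>real_of_int k\<bar> * \<nu> n k) summable_on UNIV"
    and "\<And>n. n \<ge> 1 \<Longrightarrow> mean_int (\<nu> n) = 0"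
    and "\<And>n. n \<ge> 1 \<Longrightarrow> m1_int (\<nu> n) \<le> a"
    and "\<And>n \<beta> r. n \<ge> 1 \<Longrightarrow> \<beta> \<notin> {1, -1} \<Longrightarrow> coset_mass (\<nu> n) \<beta> r \<le> \<rho>"
    and "\<And>n. n \<ge> 1 \<Longrightarrow> (\<lambda>k. (real_of_int k)\<^sup>2 * \<nu> n k) summable_on UNIV"
    and "\<exists>C. \<forall>n\<ge>1. (\<Sum>i=1..n. m2_int (\<nu> i)) \<le> C * real n"
    and "integrable M f"
  shows "AE x in M. convergent
           (\<lambda>n. \<Sum>\<^sub>\<infinity>k\<in>UNIV. conv_prod \<nu> n k * f (int_iter \<tau> (space M) k x))"
proof -
  define \<sigma> where "\<sigma> = the_inv_into (space M) \<tau>"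
  interpret inv_mpt M \<tau> \<sigma>
  proof (intro inv_mpt.intro inv_mpt_axioms.intro)
    show "\<tau> (\<sigma> x) = x" "\<sigma> (\<tau> x) = x" if "x \<in> space M" for x
      using assms(4) that unfolding \<sigma>_def bij_betw_def
      by (simp_all add: f_the_inv_into_f the_inv_into_f_f)
  qed (use assms in \<open>simp_all add: \<sigma>_def\<close>)
  obtain B where B: "\<And>n. n \<ge> 1 \<Longrightarrow> (\<Sum>i=1..n. m2_int (\<nu> i)) \<le> B * real n" using assms(18) by blast
  note kernel = conv_prod_kernel_bounds[OF assms(9-17) B]
  obtain C where C: "0 < C" "\<And>n k. 1 \<le> n \<Longrightarrow> \<bar>conv_prod \<nu> n k - conv_prod \<nu> n (k + 1)\<bar> \<le> C / real n"
    "\<And>n k. 1 \<le> n \<Longrightarrow> (real_of_int k)\<^sup>2 * conv_prod \<nu> n k \<le> C * sqrt (real n)"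
    using kernel(2) by blast
  have fabs: "integrable M (\<lambda>x. \<bar>f x\<bar>)" using assms(19) by simp
  have lin: "AE x in M. \<forall>s\<in>{\<tau>, \<sigma>}. \<exists>\<beta> K. \<forall>N. (\<Sum>k<N. \<bar>f ((s ^^ k) x)\<bar>) \<le> \<beta> * real N + K"
    by (intro AE_finite_allI AE_orbit_sum_linear_bound[OF fabs]) auto
  show ?thesis using birkhoff_two_sided[OF assms(19)] lin
  proof eventually_elim
    case (elim x)
    define g where "g k = f (int_iter \<tau> (space M) k x)" for k
    \<comment> \<open>At 0 \<open>int_iter\<close> takes its forward branch, but both iterates are
      then the identity, so the backward formula holds there too.\<close>
    have gf: "g (int k) = f ((\<tau> ^^ k) x)" and gb: "g (- int k) = f ((\<sigma> ^^ k) x)" for k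
      by (auto simp: g_def int_iter_def \<sigma>_def)
    obtain F where F: "\<And>s \<epsilon>. s \<in> {\<tau>, \<sigma>} \<Longrightarrow> 0 < \<epsilon> \<Longrightarrow> \<exists>K. \<forall>N. \<bar>(\<Sum>k<N. f ((s ^^ k) x)) - F * real N\<bar> \<le> \<epsilon> * real N + K"
      using elim(1) by blast
    have "(\<lambda>n. \<Sum>\<^sub>\<infinity>k. conv_prod \<nu> n k * g k) \<longlonglongrightarrow> F"
      by (rule int_weighted_sum_tendsto[OF C(1) kernel(1) C(2,3)]) (use F elim(2) in \<open>simp_all add: gf gb\<close>)
    thus ?case unfolding g_def by (rule convergentI)
  qed
qed

end
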